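(* Let $f\colon\mathcal{E}_\infty\to\mathcal{E}_\infty$ be a Borel map. Then there exists a Ramsey conull set $\mathcal{C}\subseteq\mathcal{E}_\infty$ such that $f$ is tracial on $\mathcal{C}$.
   Context: $\mathcal{E}_\infty$ is the set of all equivalence relations on $\mathbb{N}=\{0,1,2,\ldots\}$ with infinitely many classes. For $A,B\in\mathcal{E}_\infty$ write $A\le B$ if every $A$-class is a union of $B$-classes. For $A\in\mathcal{E}_\infty$ let $\mu_0(A)<\mu_1(A)<\cdots$ be the increasing enumeration of the minima of the $A$-classes, and let $r_n(A)$ be the restriction of $A$ to $\{0,\ldots,\mu_n(A)-1\}$ (so $r_0(A)=\emptyset$). $\mathcal{E}_\infty^{\mathrm{fin}}$ is the set of all equivalence relations on initial segments $\{0,\ldots,k-1\}$ of $\mathbb{N}$; for $s\in\mathcal{E}_\infty^{\mathrm{fin}}$, $\mathrm{dom}(s)$ is the underlying set $\{0,\ldots,k-1\}$. $\mathcal{E}_\infty$ carries the Polish topology generated by the sets $\{A: r_n(A)=s\text{ for some }n\}$, $s\in\mathcal{E}_\infty^{\mathrm{fin}}$ (equivalently, inherited from $2^{\mathbb{N}\times\mathbb{N}}$), and "Borel" refers to this topology. For $s\in\mathcal{E}_\infty^{\mathrm{fin}}$ and $A\in\mathcal{E}_\infty$, $[s,A]=\{B\in\mathcal{E}_\infty: B\le A\text{ and } s=r_n(B)\text{ for some }n\}$. A set $\mathcal{C}\subseteq\mathcal{E}_\infty$ is Ramsey conull if its complement is Ramsey null, i.e. for every $[s,A]\neq\emptyset$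 there is $B\in[s,A]$ with $[s,B]\subseteq\mathcal{C}$. For $A,B\in\mathcal{E}_\infty$ and $n\in\mathbb{N}$, the trace $\mathrm{tr}(A,B,n)$ is the restriction of $A$ to $\{0,1,\ldots,\mu_n(B)-1\}$. A map $f\colon\mathcal{E}_\infty\to\mathcal{E}_\infty$ is tracial on $\mathcal{X}\subseteq\mathcal{E}_\infty$ if for every $B\in\mathcal{X}$ there is $n_0\in\mathbb{N}$ such that for all $n\ge n_0$ and all $A,A'\le B$ for which there exist $k\in\mathbb{N}$ and $s\in\mathcal{E}_\infty^{\mathrm{fin}}$ with $s=r_k(A)=r_k(A')$ and $\mathrm{dom}(s)=\{0,\ldots,\mu_n(B)-1\}$, we have $\mathrm{tr}(f(A),B,n)=\mathrm{tr}(f(A'),B,n)$. *)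

theory Defs
  imports "HOL-Analysis.Analysis" "HOL-Library.Infinite_Set"
begin

definition Einf :: "(nat \<times> nat) set set" where
  "Einf = {A. equiv UNIV A \<and> infinite (UNIV // A)}"

(* The underlying set {..<k} is not stored separately: by reflexivity it is Domain s. *)
definition Efin :: "(nat \<times> nat) set set" where
  "Efin = {s. \<exists>k. equiv {..<k} s}"

definition coarser :: "(nat \<times> nat) set \<Rightarrow> (nat \<times> nat) set \<Rightarrow> bool" (infix "\<preceq>" 50) where
  "A \<preceq> B \<longleftrightarrow> (\<forall>X \<in> UNIV // A. \<exists>S \<subseteq> UNIV // B. X = \<Union>S)"

definition minima :: "(nat \<times> nat) set \<Rightarrow> nat set" where
  "minima A = {LEAST x. x \<in> X | X. X \<in> UNIV // A}"

definition mu :: "(nat \<times> nat) set \<Rightarrow> nat \<Rightarrow> nat" where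
  "mu A n = enumerate (minima A) n"

definition restr :: "nat \<Rightarrow> (nat \<times> nat) set \<Rightarrow> (nat \<times> nat) set" where
  "restr n A = Restr A {..<mu A n}"

definition basic :: "(nat \<times> nat) set \<Rightarrow> (nat \<times> nat) set \<Rightarrow> (nat \<times> nat) set set" where
  "basic s A = {B \<in> Einf. B \<preceq> A \<and> (\<exists>n. s = restr n B)}"

definition Einf_topology :: "(nat \<times> nat) set topology" where
  "Einf_topology = topology_generated_by {{A \<in> Einf. \<exists>n. restr n A = s} | s. s \<in> Efin}"

definition Einf_borel :: "(nat \<times> nat) set measure" where
  "Einf_borel = sigma Einf {U. openin Einf_topology U}"

definition ramsey_null :: "(nat \<times> nat) set set \<Rightarrow> bool" where
  "ramsey_null X \<longleftrightarrow> X \<subseteq> Einf \<and>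
     (\<forall>s \<in> Efin. \<forall>A \<in> Einf. basic s A \<noteq> {} \<longrightarrow>
        (\<exists>B \<in> basic s A. basic s B \<inter> X = {}))"

definition ramsey_conull :: "(nat \<times> nat) set set \<Rightarrow> bool" where
  "ramsey_conull C \<longleftrightarrow> C \<subseteq> Einf \<and> ramsey_null (Einf - C)"

definition tr :: "(nat \<times> nat) set \<Rightarrow> (nat \<times> nat) set \<Rightarrow> nat \<Rightarrow> (nat \<times> nat) set" where
  "tr A B n = Restr A {..<mu B n}"

definition tracial_on ::
  "((nat \<times> nat) set \<Rightarrow> (nat \<times> nat) set) \<Rightarrow> (nat \<times> nat) set set \<Rightarrow> bool" where
  "tracial_on f X \<longleftrightarrow>
     (\<forall>B \<in> X. \<exists>n0. \<forall>n \<ge> n0. \<forall>A \<in> Einf. \<forall>A' \<in> Einf.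
        A \<preceq> B \<longrightarrow> A' \<preceq> B \<longrightarrow>
        (\<exists>k. \<exists>s \<in> Efin. s = restr k A \<and> s = restr k A' \<and> Domain s = {..<mu B n}) \<longrightarrow>
        tr (f A) B n = tr (f A') B n)"

lemma restr_in_Efin:
  assumes "A \<in> Einf"
  shows "restr n A \<in> Efin"
proof -
  have "equiv {..<mu A n} (Restr A {..<mu A n})"
  proof (rule equivI)
    have "equiv UNIV A"
      using assms by (simp add: Einf_def)
    then have A: "refl A" "sym A" "trans A"
      by (auto elim: equivE)
    show "refl_on {..<mu A n} (Restr A {..<mu A n})"
      using A(1) by (auto simp: refl_on_def)
    show "sym (Restr A {..<mu A n})"
      using A(2) by (auto intro!: symI dest: symD)
    show "trans (Restr A {..<mu A n})"
      using A(3) by (rule trans_Restr)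
  qed auto
  then show ?thesis
    unfolding Efin_def restr_def by blast
qed

lemma topspace_Einf_topology: "topspace Einf_topology = Einf"
proof
  show "topspace Einf_topology \<subseteq> Einf"
    by (auto simp: Einf_topology_def topology_generated_by_topspace)
  show "Einf \<subseteq> topspace Einf_topology"
  proof
    fix A
    assume A: "A \<in> Einf"
    have "{A' \<in> Einf. \<exists>n. restr n A' = restr 0 A} \<in> {{A \<in> Einf. \<exists>n. restr n A = s} | s. s \<in> Efin}"
      using restr_in_Efin[OF A, of 0] by (intro CollectI exI[of _ "restr 0 A"]) simp
    moreover have "A \<in> {A' \<in> Einf. \<exists>n. restr n A' = restr 0 A}"
      using A by auto
    ultimately show "A \<in> topspace Einf_topology"
      unfolding Einf_topology_def topology_generated_by_topspace by (rule UnionI)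
  qed
qed

lemma space_Einf_borel: "space Einf_borel = Einf"
  unfolding Einf_borel_def by (simp add: space_measure_of_conv)

lemma sets_Einf_borel: "sets Einf_borel = sigma_sets Einf {U. openin Einf_topology U}"
  unfolding Einf_borel_def
  using openin_subset[of Einf_topology] by (intro sets_measure_of) (auto simp: topspace_Einf_topology)

lemma infinite_minima:
  assumes "A \<in> Einf"
  shows "infinite (minima A)"
proof -
  have eqv: "equiv UNIV A" and inf: "infinite (UNIV // A)"
    using assms by (auto simp: Einf_def)
  have least: "(LEAST x. x \<in> X) \<in> X" if "X \<in> UNIV // A" for X
    using in_quotient_imp_non_empty[OF eqv that] by (auto intro: LeastI)
  have "inj_on (\<lambda>X. LEAST x. x \<in> X) (UNIV // A)"
  proof (rule inj_onI)
    fix X Y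
    assume X: "X \<in> UNIV // A" and Y: "Y \<in> UNIV // A"
      and eq: "(LEAST x. x \<in> X) = (LEAST x. x \<in> Y)"
    then have "X \<inter> Y \<noteq> {}"
      using least[OF X] least[OF Y] by (metis IntI empty_iff)
    then show "X = Y"
      using quotient_disj[OF eqv X Y] by blast
  qed
  moreover have "minima A = (\<lambda>X. LEAST x. x \<in> X) ` (UNIV // A)"
    unfolding minima_def by auto
  ultimately show ?thesis
    using inf finite_imageD by metis
qed

lemma strict_mono_mu: "A \<in> Einf \<Longrightarrow> strict_mono (mu A)"
  unfolding mu_def using infinite_minima by (simp add: strict_mono_def)

lemma range_mu: "A \<in> Einf \<Longrightarrow> range (mu A) = minima A"
  unfolding mu_def using infinite_minima range_enumerate by blast

end

theory Submission
  imports Defs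
begin

text \<open>Equivalence relations with infinitely many classes correspond to rigid surjections of the
  natural numbers (number the classes by their minima), and \<open>A \<preceq> B\<close> becomes left composition with a
  rigid surjection. The pigeonhole principle for this monoid is the Carlson-Simpson theorem on left
  variable words, obtained from an idempotent ultrafilter on left variable words all of whose
  substitution images lie in one minimal left ideal. Fusion and combinatorial forcing then show that
  all Borel sets are Ramsey. For fixed \<open>m\<close>, the restriction of \<open>f A\<close> to \<open>{..<m}\<close> takes
  finitely many values, each on a Borel set, so one more fusion gives below any set \<open>[s, A]\<close> an
  element at which \<open>f\<close> is tracial; and being tracial at a point is inherited by all coarser points.\<close>

subsection \<open>Idempotents in compact right topological semigroups\<close>

text \<open>Tracial behaviour at \<open>B\<close> concerns all coarser relations at once, up to a
  length \<open>mu B n\<close> that depends on the very \<open>B\<close> under construction. Write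
  \<open>A\<close> as the kernel of \<open>g \<circ> b\<close>, where \<open>b\<close> numbers the
  classes of \<open>B\<close>. An approximation of \<open>A\<close> with domain
  \<open>{..<mu B n}\<close> is then the initial part of \<open>g\<close> up to
  \<open>first g k = n\<close>, with values at most \<open>n\<close>, so there are finitely many of
  them for each \<open>n\<close>. Stage \<open>n\<close> of a fusion can treat them all, and
  \<open>mu B n\<close> is final by then, because later factors on the left fix
  \<open>0, ..., n\<close>. Each single treatment is a Ramsey statement whose core is a pigeonhole
  for one more class. Between the n-th and the next minimum a relation spells a word over the
  classes \<open>0, ..., n\<close>. A finer relation offers blocks, each with one further class as
  its variable, to be merged into an old class or kept as the next new one. A block must begin with
  its variable: only then does the word read before the new minimum consist of complete substituted
  blocks.\<close>

lemma minimal_closedin_subset: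
  assumes "compact_space T" "topspace T \<noteq> {}" "P (topspace T)"
    and chain: "\<And>\<C>. \<C> \<noteq> {} \<Longrightarrow> (\<And>S. S \<in> \<C> \<Longrightarrow> P S) \<Longrightarrow> P (\<Inter>\<C>)"
  shows "\<exists>M. M \<noteq> {} \<and> closedin T M \<and> P M \<and> (\<forall>S\<subseteq>M. S \<noteq> {} \<longrightarrow> closedin T S \<longrightarrow> P S \<longrightarrow> S = M)"
proof -
  let ?A = "{S. S \<noteq> {} \<and> closedin T S \<and> P S}"
  have "\<exists>m\<in>?A. \<forall>a\<in>?A. a \<subseteq> m \<longrightarrow> a = m"
  proof (rule predicate_Zorn)
    show "partial_order_on ?A (relation_of (\<lambda>x y. y \<subseteq> x) ?A)"
      by (rule partial_order_on_relation_ofI) auto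
  next
    fix C assume C: "C \<in> Chains (relation_of (\<lambda>x y. y \<subseteq> x) ?A)"
    then have CA: "C \<subseteq> ?A" and lin: "\<And>S T. S \<in> C \<Longrightarrow> T \<in> C \<Longrightarrow> S \<subseteq> T \<or> T \<subseteq> S"
      unfolding Chains_def relation_of_def by auto
    show "\<exists>u\<in>?A. \<forall>a\<in>C. u \<subseteq> a"
    proof (cases "C = {}")
      case True
      then show ?thesis using assms(2,3) closedin_topspace by blast
    next
      case False
      \<comment> \<open>Compactness enters here: a finite nonempty subfamily of a chain has a least
        member, so the chain has the finite intersection property.\<close>
      have "\<Inter>C \<noteq> {}"
      proof
        assume empty: "\<Inter>C = {}"
        have "\<forall>S\<in>C. closedin T S" using CA by auto
        then have "\<exists>F. finite F \<and> F \<subseteq> C \<and> \<Inter>F = {}"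
          using \<open>compact_space T\<close> empty unfolding compact_space_fip by metis
        then obtain F where F: "finite F" "F \<subseteq> C" "\<Inter>F = {}" by blast
        have "F = {} \<or> \<Inter>F \<in> F"
          using F(1,2)
        proof (induction F rule: finite_induct)
          case (insert S F)
          then consider "F = {}" | "\<Inter>F \<in> F" "S \<subseteq> \<Inter>F \<or> \<Inter>F \<subseteq> S"
            using lin[of S "\<Inter>F"] by auto
          then show ?case
          proof cases
            case 2
            then have "\<Inter>(insert S F) = S \<or> \<Inter>(insert S F) = \<Inter>F" by auto
            with 2 show ?thesis by auto
          qed auto
        qed auto
        then show False using F CA by auto
      qed
      then have "\<Inter>C \<in> ?A" using False CA by (auto intro!: closedin_Inter chain)
      then show ?thesis by blast
    qed
  qed
  then obtain m where "m \<in> ?A" "\<forall>a\<in>?A. a \<subseteq> m \<longrightarrow> a = m" ..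
  then show ?thesis by (intro exI[of _ m]) simp
qed

text \<open>Only continuity in the left argument is required, which is the continuity that
  \<open>convolve\<close> has. That products stay in the space follows from it.\<close>

definition compact_right_topological_semigroup :: "'x topology \<Rightarrow> ('x \<Rightarrow> 'x \<Rightarrow> 'x) \<Rightarrow> bool" where
  "compact_right_topological_semigroup T m \<longleftrightarrow>
     compact_space T \<and> Hausdorff_space T \<and> topspace T \<noteq> {} \<and>
     (\<forall>u v w. m (m u v) w = m u (m v w)) \<and>
     (\<forall>v\<in>topspace T. continuous_map T T (\<lambda>u. m u v))"

lemma closedin_image_mult:
  assumes "compact_right_topological_semigroup T m" "closedin T S" "v \<in> topspace T"
  shows "closedin T ((\<lambda>u. m u v) ` S)"
proof -
  have T: "compact_space T" "Hausdorff_space T" "continuous_map T T (\<lambda>u. m u v)"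
    using assms unfolding compact_right_topological_semigroup_def by blast+
  show ?thesis
    by (rule compactin_imp_closedin[OF T(2) image_compactin[OF closedin_compact_space[OF T(1) assms(2)] T(3)]])
qed

lemma mult_closed:
  assumes "compact_right_topological_semigroup T m" "u \<in> topspace T" "v \<in> topspace T"
  shows "m u v \<in> topspace T"
proof -
  have "continuous_map T T (\<lambda>u. m u v)"
    using assms unfolding compact_right_topological_semigroup_def by blast
  then show ?thesis using assms(2) by (auto simp: continuous_map_def Pi_iff)
qed

text \<open>The Ellis-Numakura lemma. In a minimal closed subsemigroup \<open>M\<close> with
  \<open>e \<in> M\<close>, the closed subsemigroup of all \<open>u \<odot> e\<close> is
  \<open>M\<close> itself, so the solutions of \<open>u \<odot> e = e\<close> in \<open>M\<close>
  form a nonempty closed subsemigroup. By minimality \<open>e\<close> is one of them.\<close>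

lemma idempotent_exists:
  fixes m :: "'x \<Rightarrow> 'x \<Rightarrow> 'x" (infixl "\<odot>" 70)
  assumes T: "compact_right_topological_semigroup T m"
  shows "\<exists>e\<in>topspace T. e \<odot> e = e"
proof -
  have compact: "compact_space T" and Hausdorff: "Hausdorff_space T" and nonempty: "topspace T \<noteq> {}"
    and assoc: "u \<odot> v \<odot> w = u \<odot> (v \<odot> w)"
    and continuous: "v \<in> topspace T \<Longrightarrow> continuous_map T T (\<lambda>u. u \<odot> v)" for u v w
    using T unfolding compact_right_topological_semigroup_def by blast+
  note mult_closed = mult_closed[OF T] and closedin_image_mult = closedin_image_mult[OF T]
  define P where "P \<equiv> \<lambda>S. \<forall>u\<in>S. \<forall>v\<in>S. u \<odot> v \<in> S"
  have "\<exists>M. M \<noteq> {} \<and> closedin T M \<and> P M \<and> (\<forall>S\<subseteq>M. S \<noteq> {} \<longrightarrow> closedin T S \<longrightarrow> P S \<longrightarrow> S = M)"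
    by (rule minimal_closedin_subset[OF compact nonempty]) (auto simp: P_def mult_closed)
  then obtain M where M: "M \<noteq> {}" "closedin T M" "P M"
    and min: "\<And>S. S \<subseteq> M \<Longrightarrow> S \<noteq> {} \<Longrightarrow> closedin T S \<Longrightarrow> P S \<Longrightarrow> S = M" by blast
  obtain e where e: "e \<in> M" "e \<in> topspace T" using M closedin_subset by blast
  have "(\<lambda>u. u \<odot> e) ` M = M"
    using closedin_image_mult[OF M(2) e(2)] M(1,3) e
    by (intro min) (auto simp: P_def simp flip: assoc)
  then obtain u where u: "u \<in> M" "u \<odot> e = e" using e by (metis (no_types, lifting) imageE)
  have "{u \<in> M. u \<odot> e = e} = M"
  proof (rule min)
    have "closedin T {u \<in> topspace T. u \<odot> e \<in> {e}}"
      using continuous[OF e(2)] closedin_Hausdorff_sing_eq[OF Hausdorff] e(2)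
      by (intro closedin_continuous_map_preimage) auto
    then have "closedin T (M \<inter> {u \<in> topspace T. u \<odot> e \<in> {e}})" using M by blast
    also have "M \<inter> {u \<in> topspace T. u \<odot> e \<in> {e}} = {u \<in> M. u \<odot> e = e}"
      using closedin_subset[OF M(2)] by auto
    finally show "closedin T {u \<in> M. u \<odot> e = e}" .
  qed (use u M(3) in \<open>auto simp: P_def assoc\<close>)
  then show ?thesis using e by auto
qed

text \<open>If \<open>L\<close> is a minimal closed left ideal and \<open>e \<in> L\<close>, then
  the products \<open>w \<odot> e\<close> already fill \<open>L\<close>. So every element of
  \<open>L\<close> ends in \<open>e\<close>, and an idempotent \<open>e\<close> is absorbed on the
  right.\<close>

lemma minimal_left_ideal:
  fixes m :: "'x \<Rightarrow> 'x \<Rightarrow> 'x" (infixl "\<odot>" 70)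
  assumes T: "compact_right_topological_semigroup T m"
  shows "\<exists>L. L \<noteq> {} \<and> closedin T L \<and> (\<forall>u\<in>topspace T. \<forall>v\<in>L. u \<odot> v \<in> L) \<and>
     (\<forall>e\<in>L. e \<odot> e = e \<longrightarrow> (\<forall>u\<in>L. u \<odot> e = u))"
proof -
  have compact: "compact_space T" and nonempty: "topspace T \<noteq> {}"
    and assoc: "u \<odot> v \<odot> w = u \<odot> (v \<odot> w)" for u v w
    using T unfolding compact_right_topological_semigroup_def by blast+
  note mult_closed = mult_closed[OF T] and closedin_image_mult = closedin_image_mult[OF T]
  define P where "P \<equiv> \<lambda>S. \<forall>u\<in>topspace T. \<forall>v\<in>S. u \<odot> v \<in> S"
  have "\<exists>M. M \<noteq> {} \<and> closedin T M \<and> P M \<and> (\<forall>S\<subseteq>M. S \<noteq> {} \<longrightarrow> closedin T S \<longrightarrow> P S \<longrightarrow> S = M)"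
    by (rule minimal_closedin_subset[OF compact nonempty]) (auto simp: P_def mult_closed)
  then obtain L where L: "L \<noteq> {}" "closedin T L" "P L"
    and min: "\<And>S. S \<subseteq> L \<Longrightarrow> S \<noteq> {} \<Longrightarrow> closedin T S \<Longrightarrow> P S \<Longrightarrow> S = L" by blast
  have "u \<odot> e = u" if e: "e \<in> L" "e \<odot> e = e" and u: "u \<in> L" for e u
  proof -
    have "e \<in> topspace T" using e L closedin_subset by blast
    then have "(\<lambda>u. u \<odot> e) ` topspace T = L"
      using closedin_image_mult[OF closedin_topspace] L e(1) nonempty mult_closed
      by (intro min) (auto simp: P_def simp flip: assoc simp del: null_topspace_iff_trivial)
    then obtain w where "u = w \<odot> e" using u by blast
    then show ?thesis using e by (simp add: assoc)
  qed
  then show ?thesis using L unfolding P_def by blast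
qed

subsection \<open>Ultrafilters on words\<close>

text \<open>Ultrafilters as Boolean homomorphisms on the power set, hence as points of a cube of
  two-point spaces, where Tychonoff's theorem is available.\<close>

definition ultra :: "('b set \<Rightarrow> bool) \<Rightarrow> bool" where
  "ultra u \<longleftrightarrow> (\<forall>A. u (- A) \<longleftrightarrow> \<not> u A) \<and> (\<forall>A B. u (A \<inter> B) \<longleftrightarrow> u A \<and> u B)"

text \<open>The Stone-Cech compactification of the discrete set \<open>S\<close>, realised inside
  that cube.\<close>

definition ultra_top :: "'b set \<Rightarrow> ('b set \<Rightarrow> bool) topology" where
  "ultra_top S = subtopology (product_topology (\<lambda>_. discrete_topology UNIV) UNIV) {u. ultra u \<and> u S}"

definition convolve :: "('b list set \<Rightarrow> bool) \<Rightarrow> ('b list set \<Rightarrow> bool) \<Rightarrow> 'b list set \<Rightarrow> bool" where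
  "convolve u v = (\<lambda>A. u {x. v {y. x @ y \<in> A}})"

lemma ultra_Compl: "ultra u \<Longrightarrow> u (- A) \<longleftrightarrow> \<not> u A"
  by (simp add: ultra_def)

lemma ultra_Int: "ultra u \<Longrightarrow> u (A \<inter> B) \<longleftrightarrow> u A \<and> u B"
  by (simp add: ultra_def)

lemma ultra_mono: "ultra u \<Longrightarrow> u A \<Longrightarrow> A \<subseteq> B \<Longrightarrow> u B"
  by (metis inf.absorb_iff1 ultra_Int)

lemma ultra_UNIV: "ultra u \<Longrightarrow> u UNIV"
  by (metis Compl_UNIV_eq ultra_Compl ultra_mono subset_UNIV)

lemma ultra_nonempty: "ultra u \<Longrightarrow> u A \<Longrightarrow> A \<noteq> {}"
  by (metis Compl_UNIV_eq ultra_Compl ultra_UNIV)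

lemma ultra_finite_INT: "finite I \<Longrightarrow> ultra u \<Longrightarrow> (\<And>i. i \<in> I \<Longrightarrow> u (A i)) \<Longrightarrow> u (\<Inter>i\<in>I. A i)"
  by (induction I rule: finite_induct) (auto simp: ultra_UNIV ultra_Int)

lemma ultra_principal: "ultra (\<lambda>A. x \<in> A)"
  by (auto simp: ultra_def)

lemma ultra_image: "ultra u \<Longrightarrow> ultra (\<lambda>A. u (g -` A))"
  by (auto simp: ultra_def vimage_Compl)

lemma ultra_convolve: "ultra u \<Longrightarrow> ultra v \<Longrightarrow> ultra (convolve u v)"
  unfolding convolve_def
  by (auto simp: ultra_def Collect_neg_eq Collect_conj_eq)

lemma convolve_assoc: "convolve (convolve u v) w = convolve u (convolve v w)"
  by (simp add: convolve_def)

lemma topspace_ultra_top: "topspace (ultra_top S) = {u. ultra u \<and> u S}"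
  by (auto simp: ultra_top_def)

lemma continuous_map_ultra_top_eval:
  "continuous_map (ultra_top S) (discrete_topology UNIV) (\<lambda>u. u A)"
  unfolding ultra_top_def
  by (intro continuous_map_from_subtopology continuous_map_product_projection) auto

lemma Hausdorff_ultra_top: "Hausdorff_space (ultra_top S)"
  unfolding ultra_top_def
  by (intro Hausdorff_space_subtopology) (simp add: Hausdorff_space_product_topology)

text \<open>Each clause of \<open>ultra\<close> constrains at most three coordinates and is
  therefore closed, so the ultrafilters form a closed subset of the compact cube.\<close>

lemma compact_ultra_top: "compact_space (ultra_top S)"
proof -
  let ?P = "product_topology (\<lambda>_ :: 'a set. discrete_topology (UNIV :: bool set)) UNIV"
  have P: "compact_space ?P"
    by (simp add: compact_space_product_topology compact_space_discrete_topology)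
  have ev: "continuous_map ?P (discrete_topology UNIV) (\<lambda>u. u A)" for A
    by (rule continuous_map_product_projection) auto
  have cl: "closedin ?P {u. Q (u A) (u B) (u C)}" for Q A B C
  proof -
    have "continuous_map ?P (prod_topology (discrete_topology UNIV) (prod_topology (discrete_topology UNIV) (discrete_topology UNIV))) (\<lambda>u. (u A, u B, u C))"
      by (intro continuous_map_pairedI ev)
    then have "continuous_map ?P (discrete_topology UNIV) (\<lambda>u. (u A, u B, u C))"
      by (simp flip: prod_topology_discrete_topology UNIV_Times_UNIV)
    from closedin_continuous_map_preimage[OF this, of "{(x, y, z). Q x y z}"]
    show ?thesis by simp
  qed
  have "{u. ultra u \<and> u S} = (\<Inter>A. {u. u (- A) \<longleftrightarrow> \<not> u A}) \<inter> (\<Inter>A. \<Inter>B. {u. u (A \<inter> B) \<longleftrightarrow> u A \<and> u B}) \<inter> {u. u S}"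
    by (auto simp: ultra_def)
  also have "closedin ?P \<dots>"
    using cl[of "\<lambda>a b c. a = (\<not> b)"] cl[of "\<lambda>a b c. a = (b \<and> c)"] cl[of "\<lambda>a b c. a"]
    by (intro closedin_Int closedin_INT) auto
  finally have "compactin ?P {u. ultra u \<and> u S}"
    by (rule closedin_compact_space[OF P])
  then show ?thesis
    unfolding ultra_top_def by (rule compact_space_subtopology)
qed

lemma continuous_map_into_ultra_top:
  assumes "\<And>A. continuous_map X (discrete_topology UNIV) (\<lambda>u. f u A)"
    and "\<And>u. u \<in> topspace X \<Longrightarrow> ultra (f u) \<and> f u S"
  shows "continuous_map X (ultra_top S) f"
  unfolding ultra_top_def using assms
  by (intro continuous_map_into_subtopology) (auto simp: continuous_map_componentwise_UNIV)

lemma convolve_semigroup: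
  assumes S: "\<And>x y. x \<in> S \<Longrightarrow> y \<in> S \<Longrightarrow> x @ y \<in> S" and "closedin (ultra_top S) C" "C \<noteq> {}"
    and C: "\<And>u v. u \<in> C \<Longrightarrow> v \<in> C \<Longrightarrow> convolve u v \<in> C"
  shows "compact_right_topological_semigroup (subtopology (ultra_top S) C) convolve"
  unfolding compact_right_topological_semigroup_def
proof (intro conjI allI ballI)
  have sub: "C \<subseteq> topspace (ultra_top S)" by (rule closedin_subset) fact
  then have top: "topspace (subtopology (ultra_top S) C) = C" by (simp add: inf.absorb2)
  show "compact_space (subtopology (ultra_top S) C)"
    using assms(2) closedin_compact_space compact_space_subtopology compact_ultra_top by blast
  show "Hausdorff_space (subtopology (ultra_top S) C)"
    by (intro Hausdorff_space_subtopology Hausdorff_ultra_top)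
  show "topspace (subtopology (ultra_top S) C) \<noteq> {}"
    unfolding top by fact
  show "convolve (convolve u v) w = convolve u (convolve v w)" for u v w :: "'a list set \<Rightarrow> bool"
    by (rule convolve_assoc)
  fix v assume "v \<in> topspace (subtopology (ultra_top S) C)"
  then have v: "v \<in> C" by (simp add: top)
  have "continuous_map (subtopology (ultra_top S) C) (ultra_top S) (\<lambda>u. convolve u v)"
  proof (rule continuous_map_into_ultra_top)
    show "continuous_map (subtopology (ultra_top S) C) (discrete_topology UNIV) (\<lambda>u. convolve u v A)" for A
      unfolding convolve_def
      by (intro continuous_map_from_subtopology continuous_map_ultra_top_eval)
  qed (use C[OF _ v] sub in \<open>auto simp: topspace_ultra_top\<close>)
  then show "continuous_map (subtopology (ultra_top S) C) (subtopology (ultra_top S) C) (\<lambda>u. convolve u v)"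
    using C[OF _ v] by (auto intro: continuous_map_into_subtopology simp: top)
qed

lemma convolve_concentrated:
  assumes "\<And>x y. x \<in> S \<Longrightarrow> y \<in> S' \<Longrightarrow> x @ y \<in> S" "ultra u" "ultra v" "u S" "v S'"
  shows "convolve u v S"
proof -
  have "S \<subseteq> {x. v {y. x @ y \<in> S}}"
    using assms by (auto intro!: ultra_mono[OF \<open>ultra v\<close> \<open>v S'\<close>])
  then show ?thesis unfolding convolve_def using assms ultra_mono by blast
qed

section \<open>Variable words and substitution\<close>

definition substitute :: "'a \<Rightarrow> 'a option list \<Rightarrow> 'a list" where
  "substitute a = map (case_option a id)"

lemma substitute_append [simp]: "substitute a (v @ w) = substitute a v @ substitute a w"
  by (simp add: substitute_def)

text \<open>\<open>None\<close> is the variable. Its place at the front later puts the minimum of a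
  new class at the first letter of a block.\<close>

definition left_variable_words :: "'a set \<Rightarrow> 'a option list set" where
  "left_variable_words L = {w \<in> lists (insert None (Some ` L)). w \<noteq> [] \<and> hd w = None}"

lemma substitute_in_lists: "a \<in> L \<Longrightarrow> w \<in> left_variable_words L \<Longrightarrow> substitute a w \<in> lists L"
  by (force simp: substitute_def left_variable_words_def in_lists_conv_set split: option.splits)

lemma append_left_variable_words:
  "v \<in> left_variable_words L \<Longrightarrow> w \<in> left_variable_words L \<Longrightarrow> v @ w \<in> left_variable_words L"
  by (auto simp: left_variable_words_def)

abbreviation push :: "('b \<Rightarrow> 'c) \<Rightarrow> ('b set \<Rightarrow> bool) \<Rightarrow> 'c set \<Rightarrow> bool" where
  "push g u \<equiv> (\<lambda>A. u (g -` A))"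

text \<open>Substitution respects concatenation, hence also the product of ultrafilters; in
  particular it maps idempotents to idempotents.\<close>

lemma push_convolve:
  "push (substitute a) (convolve u v) = convolve (push (substitute a) u) (push (substitute a) v)"
  by (simp add: convolve_def vimage_def)

text \<open>The left variable words form a right ideal, so translating an ultrafilter of a minimal left
  ideal by the variable gives an ultrafilter all of whose substitution images stay in that ideal;
  this is what makes the first letter of the words available as a variable.\<close>

lemma left_variable_ultrafilter:
  assumes "L \<noteq> {}"
  obtains q where "ultra q" "q (left_variable_words L)"
    "\<And>a b. a \<in> L \<Longrightarrow> b \<in> L \<Longrightarrow>
       convolve (push (substitute a) q) (push (substitute b) q) = push (substitute a) q"
proof -
  let ?W = "lists L" and ?V = "left_variable_words L"
  have "compact_right_topological_semigroup (subtopology (ultra_top ?W) (topspace (ultra_top ?W))) convolve"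
  proof (rule convolve_semigroup)
    have "(\<lambda>A. [] \<in> A) \<in> topspace (ultra_top ?W)"
      by (simp add: topspace_ultra_top ultra_principal)
    then show "topspace (ultra_top ?W) \<noteq> {}" by blast
    show "convolve u v \<in> topspace (ultra_top ?W)"
      if "u \<in> topspace (ultra_top ?W)" "v \<in> topspace (ultra_top ?W)" for u v :: "'a list set \<Rightarrow> bool"
      using that convolve_concentrated[of ?W ?W u v] by (auto simp: topspace_ultra_top ultra_convolve)
  qed auto
  then have W: "compact_right_topological_semigroup (ultra_top ?W) convolve"
    unfolding subtopology_topspace .
  obtain I where "I \<noteq> {} \<and> closedin (ultra_top ?W) I \<and>
    (\<forall>u\<in>topspace (ultra_top ?W). \<forall>v\<in>I. convolve u v \<in> I) \<and>
    (\<forall>e\<in>I. convolve e e = e \<longrightarrow> (\<forall>u\<in>I. convolve u e = u))"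
    using minimal_left_ideal[OF W] ..
  then have I: "I \<noteq> {}" "closedin (ultra_top ?W) I"
    "\<And>u v. u \<in> topspace (ultra_top ?W) \<Longrightarrow> v \<in> I \<Longrightarrow> convolve u v \<in> I"
    and idem: "\<And>e u. e \<in> I \<Longrightarrow> convolve e e = e \<Longrightarrow> u \<in> I \<Longrightarrow> convolve u e = u"
    by blast+
  have I_sub: "u \<in> topspace (ultra_top ?W)" if "u \<in> I" for u
    using that I(2) closedin_subset by blast
  \<comment> \<open>An idempotent \<open>q\<close> of this closed semigroup has idempotent images,
    all in \<open>I\<close>, and every idempotent of \<open>I\<close> is a right identity of
    \<open>I\<close>. This yields the absorption law for any two letters.\<close>
  define C where "C = {u \<in> topspace (ultra_top ?V). \<forall>a\<in>L. push (substitute a) u \<in> I}"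
  have push_W: "push (substitute a) u \<in> topspace (ultra_top ?W)" if "u \<in> topspace (ultra_top ?V)" "a \<in> L" for a u
  proof -
    have "?V \<subseteq> substitute a -` ?W" using substitute_in_lists[OF that(2)] by auto
    then show ?thesis using that by (auto simp: topspace_ultra_top ultra_image intro: ultra_mono)
  qed
  have "compact_right_topological_semigroup (subtopology (ultra_top ?V) C) convolve"
  proof (rule convolve_semigroup)
    have "closedin (ultra_top ?V) {u \<in> topspace (ultra_top ?V). push (substitute a) u \<in> I}" if "a \<in> L" for a
      using push_W[OF _ that] continuous_map_ultra_top_eval I(2)
      by (intro closedin_continuous_map_preimage[of _ "ultra_top ?W"] continuous_map_into_ultra_top)
         (auto simp: topspace_ultra_top)
    then have "closedin (ultra_top ?V) (\<Inter>a\<in>L. {u \<in> topspace (ultra_top ?V). push (substitute a) u \<in> I})"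
      using assms by (intro closedin_INT) auto
    also have "(\<Inter>a\<in>L. {u \<in> topspace (ultra_top ?V). push (substitute a) u \<in> I}) = C"
      using assms by (auto simp: C_def)
    finally show "closedin (ultra_top ?V) C" .
    obtain y where y: "y \<in> I" using I by blast
    then have uy: "ultra y" "y ?W" using I_sub by (auto simp: topspace_ultra_top)
    define x where "x = (\<lambda>A. y ((\<lambda>w. None # map Some w) -` A))"
    have "x ?V"
      unfolding x_def by (rule ultra_mono[OF uy]) (auto simp: left_variable_words_def)
    moreover have "ultra x" using uy by (simp add: x_def ultra_image)
    moreover have "push (substitute a) x \<in> I" if "a \<in> L" for a
    proof -
      \<comment> \<open>Substituting \<open>a\<close> into \<open>None # map Some w\<close> puts
        \<open>a\<close> in front of \<open>w\<close>. On ultrafilters this is left multiplication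
        by the point mass at \<open>[a]\<close>, which does not leave the left ideal.\<close>
      have "push (substitute a) x = convolve (\<lambda>A. [a] \<in> A) y"
        by (simp add: x_def convolve_def vimage_def substitute_def comp_def)
      then show ?thesis using I(3)[OF _ y, of "\<lambda>A. [a] \<in> A"] that
        by (simp add: topspace_ultra_top ultra_principal)
    qed
    ultimately have "x \<in> C" by (simp add: C_def topspace_ultra_top)
    then show "C \<noteq> {}" by blast
    show "convolve u v \<in> C" if uv: "u \<in> C" "v \<in> C" for u v :: "'a option list set \<Rightarrow> bool"
    proof -
      have "convolve u v \<in> topspace (ultra_top ?V)"
        using uv convolve_concentrated[of ?V ?V u v]
        by (simp add: C_def topspace_ultra_top ultra_convolve append_left_variable_words)
      moreover have "push (substitute a) (convolve u v) \<in> I" if "a \<in> L" for a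
        unfolding push_convolve using uv that by (intro I(3) push_W) (auto simp: C_def)
      ultimately show ?thesis by (simp add: C_def)
    qed
  qed (simp add: append_left_variable_words)
  from idempotent_exists[OF this] obtain q where q: "q \<in> C" "convolve q q = q" by auto
  show thesis
  proof
    show "ultra q" "q ?V" using q by (auto simp: C_def topspace_ultra_top)
    fix a b assume ab: "a \<in> L" "b \<in> L"
    have mem: "push (substitute a) q \<in> I" if "a \<in> L" for a using q(1) that by (simp add: C_def)
    have "convolve (push (substitute b) q) (push (substitute b) q) = push (substitute b) q"
      using push_convolve[where a = b and u = q and v = q] unfolding q(2) by (rule sym)
    from idem[OF mem[OF ab(2)] this mem[OF ab(1)]]
    show "convolve (push (substitute a) q) (push (substitute b) q) = push (substitute a) q" .
  qed
qed

subsection \<open>The Carlson-Simpson theorem\<close>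

text \<open>An argument in the style of Galvin and Glazer. The images \<open>e a\<close> of
  \<open>q\<close> need not coincide, but each absorbs every \<open>e b\<close> on the right. So it
  suffices that a colour is large for a single letter \<open>a0\<close>: this provides
  \<open>c\<close>, and after \<open>c\<close> every letter may be substituted. The constant start
  cannot be dropped in general, since a colouring by first letters may separate
  \<open>substitute a w\<close> for different \<open>a\<close>.\<close>

theorem Carlson_Simpson:
  assumes "finite L" "L \<noteq> {}"
  obtains c w where "c \<in> lists L" "\<And>i. w i \<in> left_variable_words L"
    "(\<forall>m a. (\<forall>i<m. a i \<in> L) \<longrightarrow> c @ concat (map (\<lambda>i. substitute (a i) (w i)) [0..<m]) \<in> Y) \<or>
     (\<forall>m a. (\<forall>i<m. a i \<in> L) \<longrightarrow> c @ concat (map (\<lambda>i. substitute (a i) (w i)) [0..<m]) \<notin> Y)"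
proof -
  obtain q where q: "ultra q" "q (left_variable_words L)"
    and absorb: "\<And>a b. a \<in> L \<Longrightarrow> b \<in> L \<Longrightarrow>
       convolve (push (substitute a) q) (push (substitute b) q) = push (substitute a) q"
    using left_variable_ultrafilter[OF \<open>L \<noteq> {}\<close>] by blast
  define e where "e a = push (substitute a) q" for a
  have e: "ultra (e a)" for a unfolding e_def using q(1) by (rule ultra_image)
  have absorb': "e a {x. e b {y. x @ y \<in> A}} \<longleftrightarrow> e a A" if "a \<in> L" "b \<in> L" for a b A
    using fun_cong[OF absorb[OF that], of A] by (simp add: convolve_def e_def)
  obtain a0 where a0: "a0 \<in> L" using \<open>L \<noteq> {}\<close> by blast
  obtain Z where Z: "Z = Y \<or> Z = - Y" "e a0 Z"
    using ultra_Compl[OF e[of a0], of Y] by blast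
  \<comment> \<open>The words of \<open>Z\<close> with \<open>e b\<close>-many continuations in
    \<open>Z\<close> for every letter \<open>b\<close>. By absorption \<open>Z'\<close> is still
    large for \<open>a0\<close>, and from a word of \<open>Z'\<close> almost all continuations lead
    back into \<open>Z'\<close>, so the choice of blocks never gets stuck.\<close>
  define Z' where "Z' = {x \<in> Z. \<forall>b\<in>L. e b {y. x @ y \<in> Z}}"
  have Z': "Z' = Z \<inter> (\<Inter>b\<in>L. {x. e b {y. x @ y \<in> Z}})" by (auto simp: Z'_def)
  have large: "e a (\<Inter>b\<in>L. {x. e b {y. x @ y \<in> A}})" if "a \<in> L" "e a A" for a A
    by (rule ultra_finite_INT[OF \<open>finite L\<close> e]) (use absorb'[OF that(1)] that(2) in blast)
  have "e a0 Z'"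
    by (simp only: Z' ultra_Int[OF e] Z(2) large[OF a0 Z(2)] simp_thms)
  have step: "e a {y. x @ y \<in> Z'}" if "x \<in> Z'" "a \<in> L" for x a
  proof -
    have "{y. x @ y \<in> Z'} = {y. x @ y \<in> Z} \<inter> (\<Inter>b\<in>L. {y. e b {z. y @ z \<in> {y. x @ y \<in> Z}}})"
      by (auto simp: Z'_def)
    moreover have xa: "e a {y. x @ y \<in> Z}" using that by (simp add: Z'_def)
    moreover note large[OF \<open>a \<in> L\<close> xa]
    ultimately show ?thesis by (simp only: ultra_Int[OF e] simp_thms)
  qed
  have "\<exists>w\<in>left_variable_words L. \<forall>g\<in>G. \<forall>a\<in>L. g @ substitute a w \<in> Z'"
    if G: "finite G" "G \<subseteq> Z'" for G
  proof -
    have "q (left_variable_words L \<inter> (\<Inter>g\<in>G. \<Inter>a\<in>L. {w. g @ substitute a w \<in> Z'}))"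
      unfolding ultra_Int[OF q(1)]
    proof (intro conjI q(2) ultra_finite_INT[OF _ q(1)] assms(1) G(1))
      fix g a assume "g \<in> G" "a \<in> L"
      then have "e a {y. g @ y \<in> Z'}" using step G(2) by blast
      then show "q {w. g @ substitute a w \<in> Z'}" by (simp add: e_def vimage_def)
    qed
    from ultra_nonempty[OF q(1) this] show ?thesis by blast
  qed
  then obtain W where W: "\<And>G. finite G \<Longrightarrow> G \<subseteq> Z' \<Longrightarrow> W G \<in> left_variable_words L"
    "\<And>G g a. finite G \<Longrightarrow> G \<subseteq> Z' \<Longrightarrow> g \<in> G \<Longrightarrow> a \<in> L \<Longrightarrow> g @ substitute a (W G) \<in> Z'"
    by metis
  have "e a0 (lists L)"
    unfolding e_def using substitute_in_lists[OF a0] by (intro ultra_mono[OF q]) auto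
  then have "e a0 (lists L \<inter> Z')" using \<open>e a0 Z'\<close> by (simp add: ultra_Int[OF e])
  then obtain c where c: "c \<in> lists L" "c \<in> Z'" using ultra_nonempty[OF e] by blast
  \<comment> \<open>All words reached after each number of blocks. These sets are finite, so one
    \<open>q\<close>-large condition per word and letter leaves a block that serves them
    all.\<close>
  define G where "G = rec_nat {c} (\<lambda>_ G. (\<lambda>(g, a). g @ substitute a (W G)) ` (G \<times> L))"
  have G: "finite (G n) \<and> G n \<subseteq> Z'" for n
    by (induction n) (use W(2) c \<open>finite L\<close> in \<open>auto simp: G_def\<close>)
  have mem: "c @ concat (map (\<lambda>i. substitute (a i) (W (G i))) [0..<m]) \<in> G m" if "\<forall>i<m. a i \<in> L" for m a
    using that
  proof (induction m)
    case (Suc m)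
    then have "(\<lambda>(g, a). g @ substitute a (W (G m))) (c @ concat (map (\<lambda>i. substitute (a i) (W (G i))) [0..<m]), a m) \<in> G (Suc m)"
      unfolding G_def nat.rec(2) by (intro imageI) auto
    then show ?case by simp
  qed (simp add: G_def)
  have "c @ concat (map (\<lambda>i. substitute (a i) (W (G i))) [0..<m]) \<in> Z" if "\<forall>i<m. a i \<in> L" for m a
    using mem[OF that] G[of m] by (auto simp: Z'_def)
  with Z(1) G show thesis
    by (intro that[OF c(1), of "\<lambda>i. W (G i)"] W(1)) auto
qed

subsection \<open>Rigid surjections\<close>

text \<open>If \<open>x\<close> and \<open>y\<close> number the classes of \<open>A\<close> and \<open>B\<close>, then \<open>first x n\<close> is \<open>mu A n\<close>,
  \<open>agree n x y\<close> means \<open>restr n A = restr n B\<close> (the value at \<open>first x n\<close> itself is included, which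
  makes the two minima coincide), and \<open>below (cyl n g) x\<close> is the basic set \<open>[s, A]\<close> where \<open>s\<close> is
  the \<open>n\<close>-th restriction of the relation numbered by \<open>g \<circ> x\<close>.\<close>

definition rigid :: "(nat \<Rightarrow> nat) \<Rightarrow> bool" where
  "rigid x \<longleftrightarrow> surj x \<and> (\<forall>i. \<forall>n<x i. \<exists>j<i. x j = n)"

definition first :: "(nat \<Rightarrow> nat) \<Rightarrow> nat \<Rightarrow> nat" where
  "first x n = (LEAST i. x i = n)"

definition agree :: "nat \<Rightarrow> (nat \<Rightarrow> nat) \<Rightarrow> (nat \<Rightarrow> nat) \<Rightarrow> bool" where
  "agree n x y \<longleftrightarrow> (\<forall>i\<le>first x n. y i = x i)"

definition cyl :: "nat \<Rightarrow> (nat \<Rightarrow> nat) \<Rightarrow> (nat \<Rightarrow> nat) set" where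
  "cyl n x = {y. rigid y \<and> agree n x y}"

definition below :: "(nat \<Rightarrow> nat) set \<Rightarrow> (nat \<Rightarrow> nat) \<Rightarrow> (nat \<Rightarrow> nat) set" where
  "below S x = (\<lambda>k. k \<circ> x) ` S"

lemma rigid_first:
  assumes "rigid x" shows "x (first x n) = n"
proof -
  have "n \<in> range x" using assms by (simp add: rigid_def)
  then obtain i where "x i = n" by auto
  then show ?thesis unfolding first_def by (rule LeastI)
qed

lemma first_le: "x i = n \<Longrightarrow> first x n \<le> i"
  unfolding first_def by (rule Least_le)

lemma rigid_pred:
  assumes "rigid x" "n < x i" shows "first x n < i"
proof -
  obtain j where "j < i" "x j = n" using assms unfolding rigid_def by blast
  then show ?thesis using first_le[of x j n] by simp
qed

lemma less_first: "rigid x \<Longrightarrow> i < first x n \<Longrightarrow> x i < n"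
  using first_le[of x i n] rigid_pred[of x n i] by linarith

lemma first_eqI: "x i = n \<Longrightarrow> (\<And>j. j < i \<Longrightarrow> x j \<noteq> n) \<Longrightarrow> first x n = i"
  unfolding first_def by (rule Least_equality) (auto simp: not_less[symmetric])

lemma rigid_le: "rigid x \<Longrightarrow> x i \<le> i"
proof (induction i rule: less_induct)
  case (less i)
  show ?case
  proof (cases "x i")
    case (Suc n)
    then obtain j where "j < i" "x j = n" using \<open>rigid x\<close> unfolding rigid_def by (metis lessI)
    then show ?thesis using less Suc by fastforce
  qed simp
qed

lemma le_first: "rigid x \<Longrightarrow> n \<le> first x n"
  by (metis rigid_first rigid_le)

lemma strict_mono_first: "rigid x \<Longrightarrow> strict_mono (first x)"
  by (intro strict_monoI rigid_pred) (simp_all add: rigid_first)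

lemma first_mono: "rigid x \<Longrightarrow> n \<le> m \<Longrightarrow> first x n \<le> first x m"
  using strict_mono_first by (simp add: strict_mono_less_eq)

lemma le_first_imp_le: "rigid x \<Longrightarrow> i \<le> first x n \<Longrightarrow> x i \<le> n"
  by (metis le_neq_implies_less less_first less_imp_le order_refl rigid_first)

lemma rigid_id [simp]: "rigid id"
  by (simp add: rigid_def)

lemma first_id [simp]: "first id n = n"
  by (intro first_eqI) auto

lemma rigid_comp:
  assumes "rigid g" "rigid y" shows "rigid (g \<circ> y)"
  unfolding rigid_def
proof (intro conjI allI impI)
  show "surj (g \<circ> y)" using assms unfolding rigid_def by (meson comp_surj)
  fix i n assume "n < (g \<circ> y) i"
  then have "first g n < y i" using assms by (simp add: rigid_pred)
  then have "first y (first g n) < i" using assms by (simp add: rigid_pred)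
  then show "\<exists>j<i. (g \<circ> y) j = n" using assms by (auto simp: rigid_first)
qed

lemma first_comp:
  assumes "rigid g" "rigid y" shows "first (g \<circ> y) n = first y (first g n)"
proof (rule first_eqI)
  show "(g \<circ> y) (first y (first g n)) = n" using assms by (simp add: rigid_first)
  fix j assume "j < first y (first g n)"
  then have "y j < first g n" using assms by (simp add: less_first)
  then show "(g \<circ> y) j \<noteq> n" using assms(1) less_first by fastforce
qed

text \<open>Divisibility in the monoid is inclusion of kernels. The quotient must be
  \<open>y\<close> read at the first occurrences of the values of \<open>x\<close>; since first
  occurrences come in increasing order, it is rigid again.\<close>

lemma rigid_factor:
  assumes x: "rigid x" and y: "rigid y" and ker: "\<And>i j. x i = x j \<Longrightarrow> y i = y j"
  obtains k where "rigid k" "y = k \<circ> x"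
proof -
  define k where "k v = y (first x v)" for v
  have eq: "y i = k (x i)" for i
    unfolding k_def by (rule ker) (simp add: rigid_first x)
  have "rigid k"
    unfolding rigid_def
  proof (intro conjI allI impI)
    have "k (x (first y u)) = u" for u using rigid_first[OF y, of u] by (simp add: eq)
    then show "surj k" by (rule surjI)
    fix v u assume "u < k v"
    then have "first y u < first x v" unfolding k_def by (rule rigid_pred[OF y])
    then have "x (first y u) < v" by (rule less_first[OF x])
    then show "\<exists>w<v. k w = u" using rigid_first[OF y, of u] by (auto simp: eq)
  qed
  then show thesis using eq by (intro that) auto
qed

section \<open>Agreement and cylinders\<close>

lemma agree_refl [simp]: "agree n x x"
  by (simp add: agree_def)

lemma agree_first: "rigid x \<Longrightarrow> agree n x y \<Longrightarrow> first y n = first x n"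
  by (intro first_eqI) (auto simp: agree_def rigid_first dest: less_first)

lemma agree_sym: "rigid x \<Longrightarrow> agree n x y \<Longrightarrow> agree n y x"
  using agree_first[of x n y] by (simp add: agree_def)

lemma agree_trans: "rigid x \<Longrightarrow> agree n x y \<Longrightarrow> agree n y z \<Longrightarrow> agree n x z"
  using agree_first[of x n y] by (simp add: agree_def)

lemma agree_mono: "rigid x \<Longrightarrow> m \<le> n \<Longrightarrow> agree n x y \<Longrightarrow> agree m x y"
  using first_mono[of x m n] by (auto simp: agree_def)

lemma agree_id: "agree n id k \<longleftrightarrow> (\<forall>i\<le>n. k i = i)"
  by (simp add: agree_def)

text \<open>The values of \<open>x\<close> up to \<open>first x m\<close> are exactly
  \<open>0, ..., m\<close>, so a right factor only repeats values. Statements below an arbitrary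
  \<open>x\<close> can thus be reduced to statements below \<open>id\<close>.\<close>

lemma agree_comp_iff:
  assumes "rigid g" "rigid x"
  shows "agree n (g \<circ> x) (h \<circ> x) \<longleftrightarrow> agree n g h"
proof -
  have "(\<forall>i\<le>first x m. h (x i) = g (x i)) \<longleftrightarrow> (\<forall>c\<le>m. h c = g c)" for m
  proof (intro iffI allI impI)
    fix c assume *: "\<forall>i\<le>first x m. h (x i) = g (x i)" "c \<le> m"
    then show "h c = g c" using first_mono[OF assms(2), of c m] rigid_first[OF assms(2), of c] by metis
  qed (use le_first_imp_le[OF assms(2)] in auto)
  then show ?thesis by (simp add: agree_def first_comp assms)
qed

lemma cyl_rigid: "k \<in> cyl n x \<Longrightarrow> rigid k"
  by (simp add: cyl_def)

lemma cyl_self [simp]: "rigid x \<Longrightarrow> x \<in> cyl n x"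
  by (simp add: cyl_def)

lemma id_in_cyl: "id \<in> cyl n id"
  by (rule cyl_self) (rule rigid_id)

lemma cyl_id_iff: "k \<in> cyl n id \<longleftrightarrow> rigid k \<and> (\<forall>i\<le>n. k i = i)"
  by (simp add: cyl_def agree_id)

lemma cyl_id_comp: "k \<in> cyl n id \<Longrightarrow> h \<in> cyl n id \<Longrightarrow> k \<circ> h \<in> cyl n id"
  by (simp add: cyl_id_iff rigid_comp)

lemma cyl_id_mono: "m \<le> n \<Longrightarrow> cyl n id \<subseteq> cyl m id"
  by (auto simp: cyl_id_iff)

lemma cyl_comp_fixing:
  assumes "rigid g" "k \<in> cyl n g" "h \<in> cyl (first g n) id"
  shows "k \<circ> h \<in> cyl n g"
  using assms by (auto simp: cyl_id_iff cyl_def rigid_comp agree_def)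

lemma cyl_agree_eq: "rigid g \<Longrightarrow> agree n g h \<Longrightarrow> rigid h \<Longrightarrow> cyl n h = cyl n g"
  unfolding cyl_def using agree_sym agree_trans by blast

lemma cyl_id_comp_cyl: "rigid g \<Longrightarrow> k \<in> cyl n id \<Longrightarrow> k \<circ> g \<in> cyl n g"
  using le_first_imp_le[of g _ n] by (auto simp: cyl_id_iff cyl_def rigid_comp agree_def)

lemma below_comp: "below S (h \<circ> x) = below (below S h) x"
  by (auto simp: below_def image_image comp_assoc)

lemma below_mono: "S \<subseteq> S' \<Longrightarrow> below S x \<subseteq> below S' x"
  by (auto simp: below_def)

lemma below_rigid: "rigid x \<Longrightarrow> (\<And>k. k \<in> S \<Longrightarrow> rigid k) \<Longrightarrow> y \<in> below S x \<Longrightarrow> rigid y"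
  by (auto simp: below_def rigid_comp)

lemma below_fixing: "h \<in> cyl n id \<Longrightarrow> below (cyl n id) (h \<circ> x) \<subseteq> below (cyl n id) x"
  unfolding below_comp by (intro below_mono) (auto simp: below_def cyl_id_comp)

lemma below_cyl_fixing:
  "rigid g \<Longrightarrow> h \<in> cyl (first g n) id \<Longrightarrow> below (cyl n g) (h \<circ> x) \<subseteq> below (cyl n g) x"
  unfolding below_comp by (intro below_mono) (auto simp: below_def cyl_comp_fixing)

text \<open>Collapsing a cylinder below \<open>g\<close> to a tail of a cylinder at the identity: \<open>h\<close> keeps the classes below
  \<open>first g n\<close> apart, and sends every later class that \<open>h' \<circ> g\<close> identifies with an early one to a
  fixed early representative.\<close>

lemma amalgamation:
  assumes g: "rigid g" and h': "h' \<in> cyl n id"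
  obtains h where "h \<in> cyl (first g n) id" "below (cyl n g) h \<subseteq> below (cyl n id) (h' \<circ> g)"
proof -
  define m where "m = first g n"
  define p where "p = h' \<circ> g"
  have p: "rigid p" "p \<in> cyl n g" "first p n = m"
    using cyl_id_comp_cyl[OF g h'] agree_first[OF g, of n p] by (simp_all add: p_def m_def cyl_def)
  \<comment> \<open>As \<open>p m = n\<close>, the shift \<open>p c - n + m\<close> fixes
    \<open>m\<close> and keeps the late values consecutive. The remaining classes have a
    \<open>p\<close>-value below \<open>n\<close>, whose first occurrence lies before
    \<open>m\<close>.\<close>
  define h where "h c = (if c < m then c else if n \<le> p c then p c - n + m else first p (p c))" for c
  have small: "first p v < m" if "v < n" for v
    using strict_mono_first[OF p(1)] that p(3) by (auto simp: strict_mono_def)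
  have nm: "n \<le> m" using le_first[OF g] by (simp add: m_def)
  have pm: "p m = n" using rigid_first[OF p(1), of n] p(3) by simp
  have hm: "h c = c" if "c \<le> m" for c using that pm by (auto simp: h_def)
  have m_le: "m \<le> first p (u + n)" for u using first_mono[OF p(1), of n "u + n"] p(3) by simp
  have h_first: "h (first p (u + n)) = u + m" for u
    using m_le[of u] by (simp add: h_def rigid_first[OF p(1)])
  have "rigid h"
    unfolding rigid_def
  proof (intro conjI allI impI)
    have "\<exists>c. h c = v" for v
    proof (cases "v < m")
      case False
      then show ?thesis using h_first[of "v - m"] by auto
    qed (auto intro!: exI[of _ v] hm)
    then show "surj h" by (metis surjI)
    fix i v assume v: "v < h i"
    consider "i \<le> m" | "i > m" "v < m" | "i > m" "m \<le> v" by linarith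
    then show "\<exists>j<i. h j = v"
    proof cases
      case 1 then show ?thesis using v hm by (intro exI[of _ v]) auto
    next
      case 2 then show ?thesis using hm by (intro exI[of _ v]) auto
    next
      case 3
      then have "n \<le> p i" using v small[of "p i"] by (auto simp: h_def split: if_splits)
      then have "v - m + n < p i" using v 3 by (auto simp: h_def)
      then have "first p (v - m + n) < i" using p(1) by (rule rigid_pred[rotated])
      then show ?thesis using 3 h_first[of "v - m"] by auto
    qed
  qed
  then have h: "h \<in> cyl m id" using hm by (simp add: cyl_id_iff)
  have "k \<circ> h \<in> below (cyl n id) p" if k: "k \<in> cyl n g" for k
  proof -
    have kr: "rigid k" using k by (rule cyl_rigid)
    have km: "k c = g c" "p c = g c" if "c \<le> m" for c
      using that k p(2) by (auto simp: cyl_def agree_def m_def)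
    \<comment> \<open>Comparing \<open>c\<close> with the canonical representative of its
      \<open>p\<close>-class shows that \<open>k \<circ> h\<close> factors through \<open>p\<close>.
      For early values this uses that \<open>k\<close> and \<open>p\<close> both agree with
      \<open>g\<close> up to \<open>m\<close>.\<close>
    have "k (h c) = k (h (first p (p c)))" for c
    proof -
      have pc: "p (first p (p c)) = p c" using p(1) by (rule rigid_first)
      have le: "first p (p c) \<le> c" by (rule first_le) simp
      show ?thesis
      proof (cases "p c < n")
        case True
        then have "h (first p (p c)) = first p (p c)" using hm small by (meson less_imp_le)
        moreover have "h c = c \<and> c < m \<or> h c = first p (p c)" using True by (auto simp: h_def)
        moreover have "k (first p (p c)) = p c" using km[of "first p (p c)"] small[OF True] pc by simp
        ultimately show ?thesis using km[of c] by auto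
      next
        case False
        then have "m \<le> first p (p c)" using first_mono[OF p(1), of n "p c"] p(3) by simp
        then show ?thesis using False le pc by (auto simp: h_def)
      qed
    qed
    then have "(k \<circ> h) i = (k \<circ> h) j" if "p i = p j" for i j using that by (metis comp_apply)
    then obtain k' where k': "rigid k'" "k \<circ> h = k' \<circ> p"
      using rigid_factor[OF p(1) rigid_comp[OF kr \<open>rigid h\<close>]] by blast
    have "k' v = v" if "v \<le> n" for v
    proof -
      have "first p v \<le> m" using first_mono[OF p(1) that] p(3) by simp
      then show ?thesis
        using hm km[of "first p v"] rigid_first[OF p(1), of v] fun_cong[OF k'(2), of "first p v"] by simp
    qed
    with k'(1) have "k' \<in> cyl n id" by (simp add: cyl_id_iff)
    then show ?thesis unfolding k'(2) below_def by blast
  qed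
  then have "below (cyl n g) h \<subseteq> below (cyl n id) (h' \<circ> g)" by (auto simp: below_def p_def)
  then show thesis using that h by (simp add: m_def)
qed

subsection \<open>The pigeonhole principle\<close>

text \<open>A member of \<open>cyl n id\<close> reads \<open>0, ..., n\<close>, then a word over
  these letters, then \<open>Suc n\<close>; by hypothesis only this word matters for
  \<open>X\<close>, so \<open>X\<close> becomes a colouring of words. The function \<open>h\<close>
  spells \<open>0, ..., n\<close>, the word \<open>c\<close> and all blocks \<open>w i\<close>, with
  a new class as the variable of each block. Composing with \<open>k\<close> substitutes letters
  into the blocks.\<close>

lemma pigeonhole_id:
  assumes "\<And>x y. x \<in> X \<Longrightarrow> rigid x \<Longrightarrow> rigid y \<Longrightarrow> agree (Suc n) x y \<Longrightarrow> y \<in> X"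
  shows "\<exists>h\<in>cyl n id. below (cyl n id) h \<subseteq> X \<or> below (cyl n id) h \<inter> X = {}"
proof -
  define Y where "Y = {w. \<exists>x\<in>X. rigid x \<and> map x [0..<Suc n + length w + 1] = [0..<Suc n] @ w @ [Suc n]}"
  obtain c w where c: "c \<in> lists {..n}" and w: "\<And>i. w i \<in> left_variable_words {..n}"
    and mono: "(\<forall>m a. (\<forall>i<m. a i \<in> {..n}) \<longrightarrow> c @ concat (map (\<lambda>i. substitute (a i) (w i)) [0..<m]) \<in> Y) \<or>
      (\<forall>m a. (\<forall>i<m. a i \<in> {..n}) \<longrightarrow> c @ concat (map (\<lambda>i. substitute (a i) (w i)) [0..<m]) \<notin> Y)"
    by (rule Carlson_Simpson[of "{..n}" Y]) auto
  define p where "p m = [0..<Suc n] @ c @ concat (map (\<lambda>i. substitute (Suc n + i) (w i)) [0..<m])" for m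
  have p_Suc: "p (Suc m) = p m @ substitute (Suc n + m) (w m)" for m by (simp add: p_def)
  have w_Cons: "\<exists>v. w i = None # v \<and> set v \<subseteq> insert None (Some ` {..n})" for i
    using w[of i] by (cases "w i") (auto simp: left_variable_words_def)
  have len: "length (p m) < length (p (Suc m))" for m
    using w_Cons[of m] by (auto simp: p_Suc substitute_def)
  have len_mono: "length (p m) \<le> length (p m')" if "m \<le> m'" for m m'
    using that by (rule lift_Suc_mono_le[of "\<lambda>m. length (p m)", rotated]) (use len in \<open>simp add: less_imp_le\<close>)
  have len_strict: "length (p m) < length (p m')" if "m < m'" for m m'
    using that by (rule lift_Suc_mono_less[of "\<lambda>m. length (p m)", rotated]) (rule len)
  have len_ge: "Suc n + m \<le> length (p m)" for m
  proof (induction m)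
    case (Suc m)
    then show ?case using len[of m] by linarith
  qed (simp add: p_def)
  have nth_mono: "p m' ! i = p m ! i" if "m \<le> m'" "i < length (p m)" for m m' i
    using that(1)
  proof (induction m' rule: dec_induct)
    case (step m')
    then show ?case using len_mono[OF step(1)] that(2) by (simp add: p_Suc nth_append)
  qed simp
  \<comment> \<open>The words \<open>p m\<close> extend one another, and \<open>p (Suc i)\<close> is
    long enough to have an entry at \<open>i\<close>.\<close>
  define h where "h i = p (Suc i) ! i" for i
  have h_nth: "h i = p m ! i" if "i < length (p m)" for i m
  proof -
    have "i < length (p (Suc i))" using len_ge[of "Suc i"] by simp
    then show ?thesis using nth_mono[of m "Suc i" i] nth_mono[of "Suc i" m i] that
      unfolding h_def by (cases "m \<le> Suc i") auto
  qed
  have map_h: "map h [0..<length (p m)] = p m" for m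
    by (rule nth_equalityI) (simp_all add: h_nth)
  have set_p: "set (p m) \<subseteq> {..<Suc n + m}" for m
  proof (induction m)
    case (Suc m)
    then show ?case using w_Cons[of m] by (fastforce simp: p_Suc substitute_def)
  qed (use c in \<open>auto simp: p_def\<close>)
  \<comment> \<open>Block \<open>m\<close> starts with its variable, so its class occurs at the very
    position where \<open>p m\<close> ends.\<close>
  have h_var: "h (length (p m)) = Suc n + m" for m
    using h_nth[OF len, of m] w_Cons[of m] by (auto simp: p_Suc substitute_def)
  have h_id: "h i = i" if "i \<le> n" for i
    using h_nth[of i 0] that by (simp add: p_def nth_append del: upt_Suc)
  have h_ge: "length (p (h i - Suc n)) \<le> i" if "n < h i" for i
  proof (rule ccontr)
    assume "\<not> ?thesis"
    then have "i < length (p (h i - Suc n))" by simp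
    then have "h i \<in> set (p (h i - Suc n))" using h_nth by (metis nth_mem)
    then show False using set_p[of "h i - Suc n"] that by auto
  qed
  have h_val: "\<exists>j. h j = v \<and> (v \<le> n \<longrightarrow> j = v) \<and> (n < v \<longrightarrow> j = length (p (v - Suc n)))" for v
    using h_id[of v] h_var[of "v - Suc n"] by (cases "v \<le> n") auto
  have "rigid h"
    unfolding rigid_def
  proof (intro conjI allI impI)
    show "surj h" using h_val by (metis surjI)
    fix i v assume v: "v < h i"
    obtain j where j: "h j = v" "v \<le> n \<Longrightarrow> j = v" "n < v \<Longrightarrow> j = length (p (v - Suc n))"
      using h_val[of v] by blast
    have "j < i"
    proof (cases "v \<le> n")
      case True
      then show ?thesis using j(2) v h_id[of i] by (cases "i \<le> n") auto
    next
      case False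
      then have "length (p (v - Suc n)) < length (p (h i - Suc n))" using v by (intro len_strict) auto
      then show ?thesis using False j(3) h_ge[of i] v by simp
    qed
    with j(1) show "\<exists>j<i. h j = v" by blast
  qed
  then have h: "h \<in> cyl n id" using h_id by (simp add: cyl_id_iff)
  have key: "\<exists>d a. (\<forall>i<d. a i \<in> {..n}) \<and>
      (k \<circ> h \<in> X \<longleftrightarrow> c @ concat (map (\<lambda>i. substitute (a i) (w i)) [0..<d]) \<in> Y)" if k: "k \<in> cyl n id" for k
  proof -
    have kr: "rigid k" and kid: "\<And>i. i \<le> n \<Longrightarrow> k i = i" using k by (auto simp: cyl_id_iff)
    define j where "j = first k (Suc n)"
    have j: "Suc n \<le> j" "k j = Suc n" using le_first[OF kr] rigid_first[OF kr] by (auto simp: j_def)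
    \<comment> \<open>\<open>k\<close> sends the variable of block \<open>d\<close> to
      \<open>Suc n\<close> and those of all earlier blocks to letters up to \<open>n\<close>, so
      exactly \<open>d\<close> blocks precede the new minimum.\<close>
    define d where "d = j - Suc n"
    define a where "a i = k (Suc n + i)" for i
    define u where "u = c @ concat (map (\<lambda>i. substitute (a i) (w i)) [0..<d])"
    have a: "a i \<in> {..n}" if "i < d" for i
    proof -
      have "Suc n + i < j" using that j(1) by (simp add: d_def)
      then show ?thesis using less_first[OF kr, of "Suc n + i" "Suc n"] by (simp add: a_def j_def)
    qed
    have "map k (substitute (Suc n + i) (w i)) = substitute (a i) (w i)" for i
      using w_Cons[of i] kid by (fastforce simp: substitute_def a_def split: option.splits)
    moreover have "map k c = c" using c kid by (auto intro: map_idI)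
    moreover have "map k [0..<Suc n] = [0..<Suc n]" using kid by (intro map_idI) auto
    ultimately have kp: "map k (p d) = [0..<Suc n] @ u"
      by (simp add: p_def u_def map_concat comp_def del: upt_Suc)
    then have lu: "length (p d) = Suc n + length u"
      by (metis length_append length_map length_upt diff_zero)
    have val: "k (h (length (p d))) = Suc n"
      using j by (simp add: h_var d_def)
    have "map (k \<circ> h) [0..<length (p d)] = [0..<Suc n] @ u"
      using map_h[of d] kp by (metis map_map)
    with val have pre: "map (k \<circ> h) [0..<Suc n + length u + 1] = [0..<Suc n] @ u @ [Suc n]"
      by (simp add: lu del: upt_Suc) (simp add: upt_Suc_append del: upt_Suc)
    have kh: "rigid (k \<circ> h)" using kr \<open>rigid h\<close> by (rule rigid_comp)
    have "k \<circ> h \<in> X" if uY: "u \<in> Y"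
    proof -
      obtain x where x: "x \<in> X" "rigid x" "map x [0..<Suc n + length u + 1] = [0..<Suc n] @ u @ [Suc n]"
        using uY unfolding Y_def by blast
      have eq: "x i = (k \<circ> h) i" if "i \<le> Suc n + length u" for i
      proof -
        have "map x [0..<Suc n + length u + 1] = map (k \<circ> h) [0..<Suc n + length u + 1]"
          unfolding x(3) pre ..
        then show ?thesis using that by (simp only: map_eq_conv set_upt) auto
      qed
      have "x (Suc n + length u) = Suc n"
        using eq[of "Suc n + length u"] val lu by simp
      then have "first x (Suc n) \<le> Suc n + length u" by (rule first_le)
      then have "agree (Suc n) x (k \<circ> h)" using eq by (simp add: agree_def)
      then show ?thesis using assms x kh by blast
    qed
    moreover have "u \<in> Y" if "k \<circ> h \<in> X" using that pre kh unfolding Y_def by blast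
    ultimately show ?thesis using a by (intro exI[of _ d] exI[of _ a]) (auto simp: u_def)
  qed
  have "below (cyl n id) h \<subseteq> X \<or> below (cyl n id) h \<inter> X = {}"
    using mono
  proof
    assume *: "\<forall>m a. (\<forall>i<m. a i \<in> {..n}) \<longrightarrow> c @ concat (map (\<lambda>i. substitute (a i) (w i)) [0..<m]) \<in> Y"
    have "k \<circ> h \<in> X" if "k \<in> cyl n id" for k using key[OF that] * by blast
    then show ?thesis by (auto simp: below_def)
  next
    assume *: "\<forall>m a. (\<forall>i<m. a i \<in> {..n}) \<longrightarrow> c @ concat (map (\<lambda>i. substitute (a i) (w i)) [0..<m]) \<notin> Y"
    have "k \<circ> h \<notin> X" if "k \<in> cyl n id" for k using key[OF that] * by blast
    then show ?thesis by (auto simp: below_def)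
  qed
  with h show ?thesis by blast
qed

lemma pigeonhole:
  assumes "\<And>x y. x \<in> X \<Longrightarrow> rigid x \<Longrightarrow> rigid y \<Longrightarrow> agree (Suc n) x y \<Longrightarrow> y \<in> X" and z: "rigid z"
  shows "\<exists>h\<in>cyl n id. below (cyl n id) (h \<circ> z) \<subseteq> X \<or> below (cyl n id) (h \<circ> z) \<inter> X = {}"
proof -
  have "\<exists>h\<in>cyl n id. below (cyl n id) h \<subseteq> {k. k \<circ> z \<in> X} \<or> below (cyl n id) h \<inter> {k. k \<circ> z \<in> X} = {}"
    using assms by (intro pigeonhole_id) (simp add: agree_comp_iff rigid_comp)
  then show ?thesis unfolding below_comp by (auto simp: below_def)
qed

subsection \<open>Fusion and Ramsey sets\<close>

lemma fusion:
  assumes z: "rigid z"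
    and step: "\<And>m x. rigid x \<Longrightarrow> \<exists>h\<in>cyl m id. Q m (h \<circ> x)"
    and mono: "\<And>m x k. rigid x \<Longrightarrow> k \<in> cyl m id \<Longrightarrow> Q m x \<Longrightarrow> Q m (k \<circ> x)"
  shows "\<exists>h\<in>cyl n id. \<forall>m\<ge>n. Q m (h \<circ> z)"
proof -
  define H where "H m x = (SOME h. h \<in> cyl m id \<and> Q m (h \<circ> x))" for m x
  have H: "H m x \<in> cyl m id" "Q m (H m x \<circ> x)" if "rigid x" for m x
    using someI_ex[of "\<lambda>h. h \<in> cyl m id \<and> Q m (h \<circ> x)"] step[OF that, of m] by (auto simp: H_def)
  define G where "G = rec_nat id (\<lambda>j g. H (n + j) (g \<circ> z) \<circ> g)"
  have G_0: "G 0 = id" by (simp add: G_def)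
  have G_Suc: "G (Suc j) = H (n + j) (G j \<circ> z) \<circ> G j" for j by (simp add: G_def)
  have G: "G j \<in> cyl n id" for j
  proof (induction j)
    case 0
    show ?case unfolding G_0 by (rule id_in_cyl)
  next
    case (Suc j)
    then have "H (n + j) (G j \<circ> z) \<in> cyl n id"
      using H(1)[OF rigid_comp[OF cyl_rigid z]] cyl_id_mono[of n "n + j"] by auto
    then show ?case unfolding G_Suc using Suc by (rule cyl_id_comp)
  qed
  have Gr: "rigid (G j)" for j using G by (rule cyl_rigid)
  have stable: "G j' i = v" if "G j i = v" "v \<le> n + j" "j \<le> j'" for i j j' v
    using that(3)
  proof (induction j' rule: dec_induct)
    case (step j')
    then show ?case using H(1)[OF rigid_comp[OF Gr z], of "n + j'"] that(2) by (simp add: G_Suc cyl_id_iff)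
  qed (fact that(1))
  \<comment> \<open>The diagonal is already stable: a rigid function has
    \<open>G i i \<le> i\<close>, which is frozen at stage \<open>i\<close>.\<close>
  define g where "g i = G i i" for i
  have g_eq: "g i = v" if "G j i = v" "v \<le> n + j" for i j v
  proof -
    have "G i i \<le> n + i" using rigid_le[OF Gr, of i i] by simp
    then have "G (max i j) i = g i" using stable[of i i "g i" "max i j"] by (simp add: g_def)
    then show ?thesis using stable[OF that, of "max i j"] by simp
  qed
  have G_g: "G j i = g i" if "i \<le> j" for i j
    using that rigid_le[OF Gr, of i i] stable[of i i "g i" j] by (simp add: g_def)
  have gr: "rigid g"
    unfolding rigid_def
  proof (intro conjI allI impI)
    have "g (first (G v) v) = v" for v by (rule g_eq[of v]) (simp_all add: rigid_first[OF Gr])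
    then show "surj g" by (rule surjI)
    fix i v assume "v < g i"
    then have "first (G i) v < i" unfolding g_def by (rule rigid_pred[OF Gr])
    then show "\<exists>j<i. g j = v" using G_g[of "first (G i) v" i] rigid_first[OF Gr, of i v] by auto
  qed
  have ker: "g i = g i'" if "G j i = G j i'" for i i' j
  proof -
    have "G (j + d) i = G (j + d) i'" for d
      by (induction d) (simp_all add: that G_Suc)
    from this[of "max i i'"] show ?thesis using G_g[of i "j + max i i'"] G_g[of i' "j + max i i'"] by simp
  qed
  have factor: "\<exists>k\<in>cyl (n + j) id. g = k \<circ> G j" for j
  proof -
    obtain k where k: "rigid k" "g = k \<circ> G j"
      using rigid_factor[OF Gr[of j] gr] ker[of j] by blast
    have "k v = v" if "v \<le> n + j" for v
      using g_eq[OF rigid_first[OF Gr, of j v] that] fun_cong[OF k(2), of "first (G j) v"]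
      by (simp add: rigid_first[OF Gr])
    then show ?thesis using k by (auto simp: cyl_id_iff)
  qed
  have "Q m (g \<circ> z)" if "n \<le> m" for m
  proof -
    \<comment> \<open>\<open>Q m\<close> is secured in passing from stage \<open>m - n\<close> to
      the next one, hence the successor.\<close>
    obtain k where k: "k \<in> cyl (n + Suc (m - n)) id" "g = k \<circ> G (Suc (m - n))" using factor by blast
    have "k \<in> cyl m id" using k(1) cyl_id_mono[of m "n + Suc (m - n)"] that by auto
    moreover have "Q m (G (Suc (m - n)) \<circ> z)"
      using H(2)[OF rigid_comp[OF Gr z], of m] that by (simp add: G_Suc comp_assoc)
    ultimately show ?thesis using mono[OF rigid_comp[OF Gr z]] by (simp add: k(2) comp_assoc)
  qed
  moreover have "g \<in> cyl n id" using G[of 0] factor[of 0] by (auto simp: G_0)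
  ultimately show ?thesis by blast
qed

text \<open>At stage \<open>m\<close> only the restrictions of \<open>g\<close> to
  \<open>{..m}\<close> matter, and rigidity leaves finitely many. Each is settled by applying
  \<open>dense\<close> below \<open>g \<circ> (h \<circ> x)\<close>; \<open>amalgamation\<close>
  turns the answer into a factor that fixes \<open>0, ..., m\<close>, so the restrictions can be
  treated one after another.\<close>

lemma fusion_cyls:
  assumes anti: "\<And>n S S'. S' \<subseteq> S \<Longrightarrow> P n S \<Longrightarrow> P n S'"
    and dense: "\<And>n x. rigid x \<Longrightarrow> \<exists>h\<in>cyl n id. P n (below (cyl n id) (h \<circ> x))"
    and z: "rigid z"
  shows "\<exists>h\<in>cyl n0 id. \<forall>g n. rigid g \<longrightarrow> n0 \<le> first g n \<longrightarrow> P n (below (cyl n g) (h \<circ> z))"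
proof -
  define Q where "Q m x \<longleftrightarrow> (\<forall>g n. rigid g \<longrightarrow> first g n = m \<longrightarrow> P n (below (cyl n g) x))" for m x
  have "\<exists>h\<in>cyl n0 id. \<forall>m\<ge>n0. Q m (h \<circ> z)"
  proof (rule fusion[OF z])
    show "Q m (k \<circ> x)" if "k \<in> cyl m id" "Q m x" for m x k
      using that anti[OF below_cyl_fixing] by (auto simp: Q_def)
  next
    fix m and x :: "nat \<Rightarrow> nat" assume x: "rigid x"
    have *: "\<exists>h\<in>cyl m id. \<forall>g n. rigid g \<longrightarrow> map g [0..<Suc m] \<in> T \<longrightarrow> first g n = m \<longrightarrow>
        P n (below (cyl n g) (h \<circ> x))" if "finite T" for T
      using that
    proof (induction T rule: finite_induct)
      case empty
      then show ?case by (intro bexI[OF _ id_in_cyl]) simp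
    next
      case (insert t T)
      then obtain h where h: "h \<in> cyl m id"
        and hT: "\<And>g n. rigid g \<Longrightarrow> map g [0..<Suc m] \<in> T \<Longrightarrow> first g n = m \<Longrightarrow> P n (below (cyl n g) (h \<circ> x))"
        by blast
      show ?case
      proof (cases "\<exists>g n. rigid g \<and> map g [0..<Suc m] = t \<and> first g n = m")
        case True
        then obtain g0 n1 where g0: "rigid g0" "map g0 [0..<Suc m] = t" "first g0 n1 = m" by blast
        have "rigid (g0 \<circ> (h \<circ> x))" using g0 cyl_rigid[OF h] x by (simp add: rigid_comp)
        then obtain h1 where h1: "h1 \<in> cyl n1 id" "P n1 (below (cyl n1 id) (h1 \<circ> (g0 \<circ> (h \<circ> x))))"
          using dense by blast
        obtain h2 where h2: "h2 \<in> cyl m id" "below (cyl n1 g0) h2 \<subseteq> below (cyl n1 id) (h1 \<circ> g0)"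
          using amalgamation[OF g0(1) h1(1)] unfolding g0(3) .
        show ?thesis
        proof (intro bexI[of _ "h2 \<circ> h"] allI impI)
          show "h2 \<circ> h \<in> cyl m id" using h h2 by (intro cyl_id_comp)
          fix g n assume g: "rigid g" "map g [0..<Suc m] \<in> insert t T" "first g n = m"
          show "P n (below (cyl n g) (h2 \<circ> h \<circ> x))"
          proof (cases "map g [0..<Suc m] \<in> T")
            case True
            then show ?thesis
              using anti[OF below_cyl_fixing[OF g(1), of h2 n "h \<circ> x"] hT[OF g(1) True g(3)]] h2(1) g(3)
              by (simp add: comp_assoc)
          next
            case False
            then have "map g [0..<Suc m] = map g0 [0..<Suc m]" using g(2) g0(2) by auto
            then have eq: "g i = g0 i" if "i \<le> m" for i using that by (auto simp del: upt_Suc)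
            \<comment> \<open>Both indices are the value at \<open>m\<close> of functions that agree
              up to \<open>m\<close>.\<close>
            have "n = n1" using rigid_first[OF g(1), of n] rigid_first[OF g0(1), of n1] g(3) g0(3) eq[of m] by simp
            moreover have "cyl n g = cyl n1 g0"
              unfolding \<open>n = n1\<close> using eq g(1) g0(3) by (intro cyl_agree_eq[OF g0(1)]) (auto simp: agree_def)
            moreover have "below (cyl n1 g0) (h2 \<circ> h \<circ> x) \<subseteq> below (cyl n1 id) (h1 \<circ> (g0 \<circ> (h \<circ> x)))"
              using below_mono[OF h2(2), of "h \<circ> x"] by (simp add: comp_assoc below_comp[symmetric])
            ultimately show ?thesis using anti[OF _ h1(2)] by simp
          qed
        qed
      next
        case False
        show ?thesis
        proof (intro bexI[OF _ h] allI impI)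
          fix g n assume "rigid g" "map g [0..<Suc m] \<in> insert t T" "first g n = m"
          then show "P n (below (cyl n g) (h \<circ> x))" using hT False by blast
        qed
      qed
    qed
    have "finite {t. set t \<subseteq> {..m} \<and> length t = Suc m}" by (simp add: finite_lists_length_eq)
    from *[OF this] obtain h where h: "h \<in> cyl m id"
      "\<And>g n. rigid g \<Longrightarrow> map g [0..<Suc m] \<in> {t. set t \<subseteq> {..m} \<and> length t = Suc m} \<Longrightarrow> first g n = m \<Longrightarrow>
        P n (below (cyl n g) (h \<circ> x))"
      by blast
    have "map g [0..<Suc m] \<in> {t. set t \<subseteq> {..m} \<and> length t = Suc m}" if "rigid g" for g
      using le_trans[OF rigid_le[OF that]] by (auto simp del: upt_Suc simp: less_Suc_eq_le)
    with h show "\<exists>h\<in>cyl m id. Q m (h \<circ> x)" unfolding Q_def by blast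
  qed
  then show ?thesis unfolding Q_def by blast
qed

text \<open>The completely Ramsey property. The sets \<open>below (cyl n id) x\<close> are the basic
  sets \<open>[s, A]\<close> with \<open>s\<close> an initial part of \<open>A\<close>; every
  nonempty basic set contains one of these with the same \<open>s\<close>.\<close>

definition ramsey :: "(nat \<Rightarrow> nat) set \<Rightarrow> bool" where
  "ramsey X \<longleftrightarrow> (\<forall>x n. rigid x \<longrightarrow> (\<exists>h\<in>cyl n id.
     below (cyl n id) (h \<circ> x) \<subseteq> X \<or> below (cyl n id) (h \<circ> x) \<inter> X = {}))"

text \<open>Nash-Williams' combinatorial forcing: a cylinder is accepted if it lies inside the open set; the
  pigeonhole principle propagates rejection of a cylinder to all its one-step extensions.\<close>

lemma ramsey_open:
  assumes "\<And>x. x \<in> X \<Longrightarrow> rigid x \<Longrightarrow> \<exists>n. cyl n x \<subseteq> X"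
  shows "ramsey X"
  unfolding ramsey_def
proof (intro allI impI)
  fix z :: "nat \<Rightarrow> nat" and n assume z: "rigid z"
  \<comment> \<open>Every cylinder is decided: it is accepted, or no element \<open>y\<close> of it
    can serve as a new bound below which the tail is accepted.\<close>
  have "\<exists>h\<in>cyl n id. \<forall>g m. rigid g \<longrightarrow> n \<le> first g m \<longrightarrow>
    below (cyl m g) (h \<circ> z) \<subseteq> X \<or> (\<forall>y\<in>below (cyl m g) (h \<circ> z). \<not> below (cyl m id) y \<subseteq> X)"
  proof (rule fusion_cyls[OF _ _ z])
    fix m and x :: "nat \<Rightarrow> nat" assume x: "rigid x"
    show "\<exists>h\<in>cyl m id. below (cyl m id) (h \<circ> x) \<subseteq> X \<or>
      (\<forall>y\<in>below (cyl m id) (h \<circ> x). \<not> below (cyl m id) y \<subseteq> X)"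
    proof (cases "\<exists>h\<in>cyl m id. below (cyl m id) (h \<circ> x) \<subseteq> X")
      case False
      then show ?thesis by (intro bexI[OF _ id_in_cyl]) (auto simp: below_def)
    qed blast
  qed blast
  then obtain h where h: "h \<in> cyl n id" and dec: "\<And>g m. rigid g \<Longrightarrow> n \<le> first g m \<Longrightarrow>
    below (cyl m g) (h \<circ> z) \<subseteq> X \<or> (\<forall>y\<in>below (cyl m g) (h \<circ> z). \<not> below (cyl m id) y \<subseteq> X)"
    by blast
  define b where "b = h \<circ> z"
  have b: "rigid b" using cyl_rigid[OF h] z by (simp add: b_def rigid_comp)
  \<comment> \<open>Membership depends on \<open>k\<close> only up to
    \<open>first k (Suc m)\<close>, which is what the pigeonhole principle requires.\<close>
  define acc where "acc m = {k. below (cyl (Suc m) k) b \<subseteq> X}" for m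
  have "\<exists>h'\<in>cyl n id. \<forall>g m. rigid g \<longrightarrow> n \<le> first g m \<longrightarrow>
    below (cyl m g) (h' \<circ> id) \<subseteq> acc m \<or> below (cyl m g) (h' \<circ> id) \<inter> acc m = {}"
  proof (rule fusion_cyls[OF _ _ rigid_id])
    fix m and x :: "nat \<Rightarrow> nat" assume x: "rigid x"
    show "\<exists>h\<in>cyl m id. below (cyl m id) (h \<circ> x) \<subseteq> acc m \<or> below (cyl m id) (h \<circ> x) \<inter> acc m = {}"
    proof (rule pigeonhole[OF _ x])
      fix g k assume "g \<in> acc m" "rigid g" "rigid k" "agree (Suc m) g k"
      then show "k \<in> acc m" using cyl_agree_eq[of g "Suc m" k] by (simp add: acc_def)
    qed
  qed blast
  then obtain h' where h': "h' \<in> cyl n id" and hom: "\<And>g m. rigid g \<Longrightarrow> n \<le> first g m \<Longrightarrow>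
    below (cyl m g) h' \<subseteq> acc m \<or> below (cyl m g) h' \<inter> acc m = {}"
    by auto
  show "\<exists>h\<in>cyl n id. below (cyl n id) (h \<circ> z) \<subseteq> X \<or> below (cyl n id) (h \<circ> z) \<inter> X = {}"
  proof (cases "below (cyl n id) b \<subseteq> X")
    case True
    then show ?thesis using h by (auto simp: b_def)
  next
    case False
    \<comment> \<open>If all one-step extensions of a rejected cylinder were accepted, every
      \<open>k' \<circ> h' \<circ> b\<close> would lie in \<open>X\<close>, so the tail below
      \<open>k \<circ> h' \<circ> b\<close> would be accepted, against \<open>dec\<close>. By
      homogeneity none of them is accepted.\<close>
    have rej: "\<not> below (cyl m (k \<circ> h')) b \<subseteq> X" if "n \<le> m" "k \<in> cyl n id" for m k
      using that(1)
    proof (induction m rule: dec_induct)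
      case base
      have "cyl n (k \<circ> h') = cyl n id"
        using that h' by (intro cyl_agree_eq[OF rigid_id]) (auto simp: cyl_id_iff agree_id rigid_comp)
      then show ?case using False by metis
    next
      case (step m)
      have k: "rigid k" "rigid (k \<circ> h')" using that(2) h' cyl_rigid rigid_comp by blast+
      have le: "n \<le> first k m" "n \<le> first (k \<circ> h') m" using step(1) le_first k by (meson le_trans)+
      have kh: "k \<circ> h' \<in> below (cyl m k) h'" using k(1) by (auto simp: below_def)
      have "\<not> below (cyl m k) h' \<subseteq> acc m"
      proof
        assume sub: "below (cyl m k) h' \<subseteq> acc m"
        have "k' \<circ> h' \<circ> b \<in> X" if "k' \<in> cyl m k" for k'
        proof -
          have "k' \<circ> h' \<in> acc m" using sub that by (auto simp: below_def)
          moreover have "rigid (k' \<circ> h')" using cyl_rigid[OF that] cyl_rigid[OF h'] by (rule rigid_comp)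
          ultimately show ?thesis by (force simp: acc_def below_def)
        qed
        then have "below (cyl m id) (k \<circ> h' \<circ> b) \<subseteq> X"
          using cyl_id_comp_cyl[OF k(1)] by (auto simp: below_def simp flip: comp_assoc)
        moreover have "k \<circ> h' \<circ> b \<in> below (cyl m (k \<circ> h')) b" using k(2) by (auto simp: below_def)
        ultimately show False using dec[OF k(2) le(2)] step.IH unfolding b_def by blast
      qed
      then have "k \<circ> h' \<notin> acc m" using hom[OF k(1) le(1)] kh by blast
      then show ?case by (simp add: acc_def comp_def)
    qed
    \<comment> \<open>Openness finishes the argument: an element of \<open>X\<close> has a whole
      cylinder inside \<open>X\<close>, whose part below \<open>b\<close> would be accepted.\<close>
    have "k \<circ> (h' \<circ> b) \<notin> X" if k: "k \<in> cyl n id" for k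
    proof
      assume X: "k \<circ> (h' \<circ> b) \<in> X"
      have kr: "rigid (k \<circ> h')" using k h' cyl_rigid rigid_comp by blast
      obtain m where m: "cyl m (k \<circ> (h' \<circ> b)) \<subseteq> X"
        using assms[OF X] rigid_comp[OF kr b] by (auto simp: comp_assoc)
      have "below (cyl (max m n) (k \<circ> h')) b \<subseteq> X"
      proof
        fix y assume "y \<in> below (cyl (max m n) (k \<circ> h')) b"
        then obtain l where l: "y = l \<circ> b" "rigid l" "agree (max m n) (k \<circ> h') l"
          by (auto simp: below_def cyl_def)
        then have "agree m (k \<circ> h' \<circ> b) (l \<circ> b)"
          using agree_mono[OF kr _ l(3), of m] by (simp add: agree_comp_iff kr b)
        then have "y \<in> cyl m (k \<circ> (h' \<circ> b))"
          using l b by (simp add: cyl_def rigid_comp comp_assoc)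
        then show "y \<in> X" using m by blast
      qed
      then show False using rej[OF _ k, of "max m n"] by simp
    qed
    then have "below (cyl n id) (h' \<circ> h \<circ> z) \<inter> X = {}" by (auto simp: below_def b_def comp_assoc)
    then show ?thesis using cyl_id_comp[OF h' h] by blast
  qed
qed

lemma ramsey_Compl: "ramsey X \<Longrightarrow> ramsey (- X)"
  unfolding ramsey_def by (metis Compl_disjoint disjoint_eq_subset_Compl double_complement inf_commute)

lemma finite_family_homogeneous:
  assumes "finite I" "\<And>i. i \<in> I \<Longrightarrow> ramsey (X i)" "rigid z"
  shows "\<exists>h\<in>cyl n id. \<forall>i\<in>I. below (cyl n id) (h \<circ> z) \<subseteq> X i \<or> below (cyl n id) (h \<circ> z) \<inter> X i = {}"
  using assms(1,2)
proof (induction I rule: finite_induct)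
  case empty
  then show ?case by (intro bexI[OF _ id_in_cyl]) simp
next
  case (insert i I)
  then obtain h where h: "h \<in> cyl n id"
    "\<forall>i\<in>I. below (cyl n id) (h \<circ> z) \<subseteq> X i \<or> below (cyl n id) (h \<circ> z) \<inter> X i = {}"
    unfolding comp_def id_def by blast
  have "rigid (h \<circ> z)" using cyl_rigid[OF h(1)] assms(3) by (rule rigid_comp)
  then obtain h' where h': "h' \<in> cyl n id"
    "below (cyl n id) (h' \<circ> (h \<circ> z)) \<subseteq> X i \<or> below (cyl n id) (h' \<circ> (h \<circ> z)) \<inter> X i = {}"
    using insert.prems[of i] unfolding ramsey_def by blast
  have "\<forall>j\<in>insert i I. below (cyl n id) (h' \<circ> h \<circ> z) \<subseteq> X j \<or> below (cyl n id) (h' \<circ> h \<circ> z) \<inter> X j = {}"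
    using h(2) h'(2) below_fixing[OF h'(1), of "h \<circ> z"] unfolding comp_assoc by blast
  then show ?case
    using cyl_id_comp[OF h'(1) h(1)] unfolding comp_def id_def
    by (intro bexI[of _ "\<lambda>x. h' (h x)"])
qed

text \<open>Fusion decides \<open>X i\<close> on all cylinders of index at least \<open>i\<close>.
  Below the resulting \<open>b\<close> the union is then relatively open, and the case of open sets
  applies.\<close>

lemma ramsey_Union:
  fixes X :: "nat \<Rightarrow> (nat \<Rightarrow> nat) set"
  assumes "\<And>i. ramsey (X i)"
  shows "ramsey (\<Union>i. X i)"
  unfolding ramsey_def
proof (intro allI impI)
  fix z :: "nat \<Rightarrow> nat" and n assume z: "rigid z"
  have "\<exists>h\<in>cyl n id. \<forall>g m. rigid g \<longrightarrow> n \<le> first g m \<longrightarrow> (\<forall>i\<in>{..m}.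
    below (cyl m g) (h \<circ> z) \<subseteq> X i \<or> below (cyl m g) (h \<circ> z) \<inter> X i = {})"
    by (rule fusion_cyls[OF _ _ z]) (blast, intro finite_family_homogeneous, auto simp: assms)
  then obtain h where h: "h \<in> cyl n id" and hom: "\<And>g m i. rigid g \<Longrightarrow> n \<le> first g m \<Longrightarrow> i \<le> m \<Longrightarrow>
    below (cyl m g) (h \<circ> z) \<subseteq> X i \<or> below (cyl m g) (h \<circ> z) \<inter> X i = {}"
    by auto
  define b where "b = h \<circ> z"
  have b: "rigid b" using cyl_rigid[OF h] z by (simp add: b_def rigid_comp)
  \<comment> \<open>An open set of the whole space that has the same elements below \<open>b\<close>
    as the union.\<close>
  define Y where "Y = {y. rigid y \<and> (\<exists>m k. rigid k \<and> agree m (k \<circ> b) y \<and> below (cyl m k) b \<subseteq> (\<Union>i. X i))}"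
  have "ramsey Y"
  proof (rule ramsey_open)
    fix y assume "y \<in> Y" "rigid y"
    then obtain m k where k: "rigid k" "agree m (k \<circ> b) y" "below (cyl m k) b \<subseteq> (\<Union>i. X i)"
      by (auto simp: Y_def)
    then have "cyl m y \<subseteq> Y"
      using agree_trans[OF rigid_comp[OF k(1) b] k(2)] by (auto simp: Y_def cyl_def)
    then show "\<exists>m. cyl m y \<subseteq> Y" ..
  qed
  have Y_eq: "y \<in> Y \<longleftrightarrow> y \<in> (\<Union>i. X i)" if y: "y \<in> below (cyl n id) b" for y
  proof
    obtain k where k: "k \<in> cyl n id" "y = k \<circ> b" using y by (auto simp: below_def)
    have kr: "rigid k" using k(1) by (rule cyl_rigid)
    {
      assume "y \<in> Y"
      then obtain m k' where k': "rigid k'" "agree m (k' \<circ> b) (k \<circ> b)" "below (cyl m k') b \<subseteq> (\<Union>i. X i)"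
        by (auto simp: Y_def k)
      then have "k \<in> cyl m k'" using kr b by (simp add: agree_comp_iff cyl_def)
      then show "y \<in> (\<Union>i. X i)" using k'(3) by (auto simp: k(2) below_def)
    next
      assume "y \<in> (\<Union>i. X i)"
      then obtain i where i: "y \<in> X i" by blast
      \<comment> \<open>The index \<open>max n i\<close> is large enough for \<open>X i\<close> to
        be among the decided sets and for \<open>first k\<close> to reach the bound \<open>n\<close>
        of the fusion.\<close>
      have yb: "y \<in> below (cyl (max n i) k) b" using kr by (auto simp: below_def k(2))
      have "n \<le> first k (max n i)" using le_first[OF kr, of "max n i"] by simp
      then have "below (cyl (max n i) k) b \<subseteq> X i"
        using hom[OF kr, of "max n i" i] i yb by (auto simp: b_def)
      moreover have "rigid y" unfolding k(2) using kr b by (rule rigid_comp)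
      moreover have "agree (max n i) (k \<circ> b) y" by (simp add: k(2))
      ultimately show "y \<in> Y" using kr unfolding Y_def by blast
    }
  qed
  obtain h' where h': "h' \<in> cyl n id"
    "below (cyl n id) (h' \<circ> b) \<subseteq> Y \<or> below (cyl n id) (h' \<circ> b) \<inter> Y = {}"
    using \<open>ramsey Y\<close> b unfolding ramsey_def by blast
  have "below (cyl n id) (h' \<circ> b) \<subseteq> below (cyl n id) b" using h'(1) by (rule below_fixing)
  with h'(2) Y_eq have "below (cyl n id) (h' \<circ> h \<circ> z) \<subseteq> (\<Union>i. X i) \<or> below (cyl n id) (h' \<circ> h \<circ> z) \<inter> (\<Union>i. X i) = {}"
    unfolding b_def comp_assoc by blast
  then show "\<exists>h\<in>cyl n id. below (cyl n id) (h \<circ> z) \<subseteq> (\<Union>i. X i) \<or> below (cyl n id) (h \<circ> z) \<inter> (\<Union>i. X i) = {}"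
    using cyl_id_comp[OF h'(1) h] by blast
qed

subsection \<open>Equivalence relations as rigid surjections\<close>

definition ker_rel :: "(nat \<Rightarrow> nat) \<Rightarrow> (nat \<times> nat) set" where
  "ker_rel x = {(i, j). x i = x j}"

lemma in_ker_rel [simp]: "(i, j) \<in> ker_rel x \<longleftrightarrow> x i = x j"
  by (simp add: ker_rel_def)

lemma equiv_ker_rel: "equiv UNIV (ker_rel x)"
  by (auto simp: ker_rel_def intro!: equivI refl_onI symI transI)

lemma ker_rel_in_Einf:
  assumes "rigid x" shows "ker_rel x \<in> Einf"
proof -
  have "inj (\<lambda>v. ker_rel x `` {first x v})"
  proof (rule injI)
    fix v w assume "ker_rel x `` {first x v} = ker_rel x `` {first x w}"
    then have "(first x v, first x w) \<in> ker_rel x" by auto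
    then show "v = w" by (simp add: rigid_first assms)
  qed
  then have "infinite (range (\<lambda>v. ker_rel x `` {first x v}))"
    by (rule range_inj_infinite)
  moreover have "range (\<lambda>v. ker_rel x `` {first x v}) \<subseteq> UNIV // ker_rel x"
    by (auto simp: quotient_def)
  ultimately show ?thesis
    unfolding Einf_def using equiv_ker_rel infinite_super by blast
qed

lemma strict_mono_range_unique:
  fixes f g :: "nat \<Rightarrow> nat"
  assumes "strict_mono f" "strict_mono g" "range f = range g"
  shows "f = g"
proof
  fix n
  have aux: False if H: "strict_mono f" "strict_mono g" "range f = range g" "\<And>k. k < n \<Longrightarrow> f k = g k" "f n < g n"
    for f g :: "nat \<Rightarrow> nat" and n
  proof -
    obtain k where k: "f n = g k" using H(3) by blast
    then have "k < n" using H(2,5) by (simp add: k strict_mono_less)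
    then have "f k = f n" using H(4) k by simp
    then show False using \<open>k < n\<close> H(1) by (simp add: strict_mono_eq)
  qed
  show "f n = g n"
  proof (induction n rule: less_induct)
    case (less n)
    then show ?case
      using aux[of f g n] aux[of g f n] assms by (metis nat_neq_iff)
  qed
qed

lemma minima_eq: "minima A = range (\<lambda>i. LEAST j. (i, j) \<in> A)"
proof -
  have "minima A = (\<lambda>X. LEAST x. x \<in> X) ` (UNIV // A)" by (auto simp: minima_def)
  also have "UNIV // A = range (\<lambda>i. A `` {i})" by (auto simp: quotient_def)
  finally show ?thesis by (simp add: image_image)
qed

lemma mu_ker_rel:
  assumes "rigid x" shows "mu (ker_rel x) = first x"
proof (rule strict_mono_range_unique)
  show "strict_mono (mu (ker_rel x))"
    using strict_mono_mu[OF ker_rel_in_Einf[OF assms]] .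
  show "strict_mono (first x)" using assms by (rule strict_mono_first)
  have "(LEAST j. (i, j) \<in> ker_rel x) = first x (x i)" for i
    by (simp add: first_def eq_commute)
  then have "minima (ker_rel x) = range (\<lambda>i. first x (x i))" by (simp add: minima_eq)
  also have "\<dots> = range (first x)"
    using assms unfolding rigid_def by (metis image_image)
  finally show "range (mu (ker_rel x)) = range (first x)"
    using range_mu[OF ker_rel_in_Einf[OF assms]] by simp
qed

text \<open>\<open>x\<close> sends each point to the index of the minimum of its class. It is rigid
  because smaller indices belong to smaller minima.\<close>

lemma Einf_eq_ker_rel:
  assumes A: "A \<in> Einf"
  obtains x where "rigid x" "A = ker_rel x"
proof -
  have eqv: "refl A" "sym A" "trans A" using A by (auto simp: Einf_def elim: equivE)
  define l where "l i = (LEAST j. (i, j) \<in> A)" for i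
  have l: "(i, l i) \<in> A" "l i \<le> i" for i
    using eqv(1) unfolding l_def by (auto intro: LeastI Least_le dest: refl_onD)
  have A_iff: "(i, j) \<in> A \<longleftrightarrow> l i = l j" for i j
  proof
    assume "(i, j) \<in> A"
    then have "(i, k) \<in> A \<longleftrightarrow> (j, k) \<in> A" for k using eqv(2,3) by (meson symD transD)
    then show "l i = l j" by (simp add: l_def)
  next
    assume "l i = l j"
    then show "(i, j) \<in> A" using l[of i] l[of j] eqv(2,3) by (metis symD transD)
  qed
  define x where "x i = inv (mu A) (l i)" for i
  have inj: "inj (mu A)" using strict_mono_mu[OF A] by (rule strict_mono_imp_inj_on)
  have "l i \<in> range (mu A)" for i using range_mu[OF A] by (auto simp: minima_eq l_def)
  then have mu_x: "mu A (x i) = l i" for i by (simp add: x_def f_inv_into_f)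
  have l_mu: "l (mu A n) = mu A n" for n
  proof -
    obtain i where i: "mu A n = l i" using range_mu[OF A] by (auto simp: minima_eq l_def)
    then show ?thesis using A_iff[of i "l i"] l[of i] by simp
  qed
  then have x_mu: "x (mu A n) = n" for n using inj by (simp add: x_def)
  have "rigid x"
    unfolding rigid_def
  proof (intro conjI allI impI)
    show "surj x" using x_mu by (rule surjI)
    fix i n assume "n < x i"
    then have "mu A n < mu A (x i)" using strict_mono_mu[OF A] by (simp add: strict_mono_less)
    then have "mu A n < i" using l(2)[of i] by (simp add: mu_x)
    then show "\<exists>j<i. x j = n" using x_mu by blast
  qed
  moreover have "A = ker_rel x"
  proof -
    have "l i = l j \<longleftrightarrow> x i = x j" for i j using mu_x by (metis x_def)
    then show ?thesis using A_iff by auto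
  qed
  ultimately show thesis by (rule that)
qed

lemma coarser_ker_rel_iff:
  assumes x: "rigid x" and y: "rigid y"
  shows "ker_rel x \<preceq> ker_rel y \<longleftrightarrow> (\<exists>g. rigid g \<and> x = g \<circ> y)"
proof
  assume le: "ker_rel x \<preceq> ker_rel y"
  have "x i = x j" if "y i = y j" for i j
  proof -
    have "ker_rel x `` {i} \<in> UNIV // ker_rel x" by (auto simp: quotient_def)
    from le[unfolded coarser_def, rule_format, OF this]
    obtain S where S: "S \<subseteq> UNIV // ker_rel y" "ker_rel x `` {i} = \<Union>S" by metis
    moreover have "i \<in> ker_rel x `` {i}" by simp
    ultimately obtain Y where Y: "Y \<in> S" "i \<in> Y" by blast
    then have "j \<in> Y" using S(1) that by (auto simp: quotient_def)
    then have "j \<in> ker_rel x `` {i}" using S(2) Y by blast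
    then show ?thesis by simp
  qed
  then show "\<exists>g. rigid g \<and> x = g \<circ> y" using rigid_factor[OF y x] by metis
next
  assume "\<exists>g. rigid g \<and> x = g \<circ> y"
  then obtain g where g: "x = g \<circ> y" by blast
  show "ker_rel x \<preceq> ker_rel y"
    unfolding coarser_def
  proof
    fix X assume "X \<in> UNIV // ker_rel x"
    then obtain i where X: "X = ker_rel x `` {i}" by (auto simp: quotient_def)
    have "X = \<Union>((\<lambda>j. ker_rel y `` {j}) ` X)"
      by (auto simp: X g)
    moreover have "(\<lambda>j. ker_rel y `` {j}) ` X \<subseteq> UNIV // ker_rel y" by (auto simp: quotient_def)
    ultimately show "\<exists>S\<subseteq>UNIV // ker_rel y. X = \<Union>S" by blast
  qed
qed

lemma Domain_restr_ker_rel: "rigid x \<Longrightarrow> Domain (restr n (ker_rel x)) = {..<first x n}"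
  by (auto simp: restr_def mu_ker_rel Domain_unfold)

lemma restr_ker_rel_eq_iff:
  assumes x: "rigid x" and y: "rigid y"
  shows "restr m (ker_rel x) = restr n (ker_rel y) \<longleftrightarrow> m = n \<and> agree n x y"
proof
  assume eq: "restr m (ker_rel x) = restr n (ker_rel y)"
  define M where "M = first x m"
  have "{..<first x m} = {..<first y n}"
    using Domain_restr_ker_rel[OF x, of m] Domain_restr_ker_rel[OF y, of n] eq by simp
  then have M: "first y n = M" by (simp add: M_def lessThan_eq_iff)
  have ker: "x i = x j \<longleftrightarrow> y i = y j" if "i < M" "j < M" for i j
  proof -
    have "(i, j) \<in> restr m (ker_rel x) \<longleftrightarrow> (i, j) \<in> restr n (ker_rel y)" using eq by simp
    then show ?thesis using that x y M by (simp add: restr_def mu_ker_rel M_def)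
  qed
  \<comment> \<open>If position \<open>i\<close> opens a new class, the numbers used before it are
    exactly those below \<open>z i\<close>.\<close>
  have img: "z ` {..<i} = {..<z i}" if "rigid z" "\<And>j. j < i \<Longrightarrow> z j \<noteq> z i" for z i
  proof -
    have "z j < z i" if "j < i" for j
    proof (rule ccontr)
      assume "\<not> z j < z i"
      then have "z i < z j" using \<open>\<And>j. j < i \<Longrightarrow> z j \<noteq> z i\<close>[OF that] by simp
      then have "first z (z i) < j" by (rule rigid_pred[OF \<open>rigid z\<close>])
      then show False using \<open>\<And>j. j < i \<Longrightarrow> z j \<noteq> z i\<close>[of "first z (z i)"] that
        by (simp add: rigid_first \<open>rigid z\<close>)
    qed
    moreover have "v \<in> z ` {..<i}" if "v < z i" for v
      using rigid_pred[OF \<open>rigid z\<close> that] rigid_first[OF \<open>rigid z\<close>, of v] by (metis imageI lessThan_iff)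
    ultimately show ?thesis by auto
  qed
  have eq_below: "x i = y i" if "i < M" for i
    using that
  proof (induction i rule: less_induct)
    case (less i)
    show ?case
    proof (cases "\<exists>j<i. x j = x i")
      case True
      then obtain j where j: "j < i" "x j = x i" by blast
      then have "y j = y i" using ker[of j i] less.prems by simp
      then show ?thesis using j less by simp
    next
      case False
      then have "\<And>j. j < i \<Longrightarrow> y j \<noteq> y i" using ker[of _ i] less.prems by simp
      then have "{..<y i} = y ` {..<i}" using img[OF y, of i] by simp
      also have "\<dots> = x ` {..<i}" using less by (intro image_cong) auto
      also have "\<dots> = {..<x i}" using img[OF x, of i] False by blast
      finally show ?thesis by (simp add: lessThan_eq_iff)
    qed
  qed
  have img_first: "z ` {..<first z k} = {..<k}" if "rigid z" for z k
    using img[OF that, of "first z k"] rigid_first[OF that] less_first[OF that] by fastforce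
  \<comment> \<open>The index is the number of classes met before the cut at
    \<open>M\<close>.\<close>
  have "{..<m} = {..<n}"
    using img_first[OF x, of m] img_first[OF y, of n] eq_below unfolding M M_def[symmetric]
    by (metis (no_types, lifting) image_cong lessThan_iff)
  then have mn: "m = n" by (simp add: lessThan_eq_iff)
  moreover have "y i = x i" if "i \<le> M" for i
    using eq_below[of i] that rigid_first[OF x, of m] rigid_first[OF y, of n] mn M M_def by (cases "i = M") auto
  ultimately show "m = n \<and> agree n x y" by (simp add: agree_def M_def)
next
  assume "m = n \<and> agree n x y"
  then show "restr m (ker_rel x) = restr n (ker_rel y)"
    using agree_first[OF x, of n y] by (auto simp: restr_def mu_ker_rel x y agree_def)
qed

section \<open>Borel sets of equivalence relations\<close>

lemma openin_Einf_cyl: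
  assumes "openin Einf_topology U" "rigid x" "ker_rel x \<in> U"
  shows "\<exists>n. \<forall>y. rigid y \<longrightarrow> agree n x y \<longrightarrow> ker_rel y \<in> U"
proof -
  have "generate_topology_on {{A \<in> Einf. \<exists>n. restr n A = s} | s. s \<in> Efin} U"
    using assms(1) by (simp add: Einf_topology_def openin_topology_generated_by_iff)
  then show ?thesis using assms(3)
  proof (induction rule: generate_topology_on.induct)
    case (Int U V)
    then obtain m n where "\<And>y. rigid y \<Longrightarrow> agree m x y \<Longrightarrow> ker_rel y \<in> U"
      "\<And>y. rigid y \<Longrightarrow> agree n x y \<Longrightarrow> ker_rel y \<in> V" by blast
    then show ?case
      using agree_mono[OF assms(2), of m "max m n"] agree_mono[OF assms(2), of n "max m n"]
      by (intro exI[of _ "max m n"]) auto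
  next
    case (UN K)
    then show ?case by blast
  next
    case (Basis U)
    then obtain s n where U: "U = {A \<in> Einf. \<exists>n. restr n A = s}" "restr n (ker_rel x) = s" by blast
    have "ker_rel y \<in> U" if "rigid y" "agree n x y" for y
      using restr_ker_rel_eq_iff[OF assms(2) that(1), of n n] that ker_rel_in_Einf[of y] U by auto
    then show ?case by blast
  qed simp
qed

lemma ramsey_cong:
  assumes "ramsey X" "\<And>x. rigid x \<Longrightarrow> x \<in> X \<longleftrightarrow> x \<in> Y"
  shows "ramsey Y"
  unfolding ramsey_def
proof (intro allI impI)
  fix x :: "nat \<Rightarrow> nat" and n assume x: "rigid x"
  obtain h where h: "h \<in> cyl n id"
    "below (cyl n id) (h \<circ> x) \<subseteq> X \<or> below (cyl n id) (h \<circ> x) \<inter> X = {}"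
    using assms(1) x unfolding ramsey_def by blast
  have "rigid y" if "y \<in> below (cyl n id) (h \<circ> x)" for y
    using below_rigid[OF rigid_comp[OF cyl_rigid[OF h(1)] x] cyl_rigid that] .
  then show "\<exists>h\<in>cyl n id. below (cyl n id) (h \<circ> x) \<subseteq> Y \<or> below (cyl n id) (h \<circ> x) \<inter> Y = {}"
    using h assms(2) by (intro bexI[OF _ h(1)]) blast
qed

lemma ramsey_borel:
  assumes "Y \<in> sets Einf_borel"
  shows "ramsey {x. ker_rel x \<in> Y}"
  using assms unfolding sets_Einf_borel
proof (induction rule: sigma_sets.induct)
  case (Basic U)
  then have "openin Einf_topology U" by simp
  from openin_Einf_cyl[OF this] have "ramsey {x. rigid x \<and> ker_rel x \<in> U}"
    by (intro ramsey_open) (fastforce simp: cyl_def)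
  then show ?case by (rule ramsey_cong) simp
next
  case Empty
  then show ?case by (intro ramsey_open) simp
next
  case (Compl Y)
  have "ramsey (- {x. ker_rel x \<in> Y})" using Compl.IH by (rule ramsey_Compl)
  then show ?case by (rule ramsey_cong) (simp add: ker_rel_in_Einf)
next
  case (Union Y)
  have "ramsey (\<Union>i. {x. ker_rel x \<in> Y i})" using Union.IH by (rule ramsey_Union)
  then show ?case by (rule ramsey_cong) simp
qed

text \<open>A single pair is decided by a sufficiently long restriction, so the set is open. A trace
  of fixed length is determined by finitely many pairs.\<close>

lemma pair_set_borel: "{A \<in> Einf. (i, j) \<in> A} \<in> sets Einf_borel"
proof -
  let ?B = "\<lambda>s. {A \<in> Einf. \<exists>n. restr n A = s}"
  have "{A \<in> Einf. (i, j) \<in> A} = \<Union>(?B ` {s \<in> Efin. (i, j) \<in> s})"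
  proof (intro equalityI subsetI)
    fix A assume A: "A \<in> {A \<in> Einf. (i, j) \<in> A}"
    define n where "n = Suc (max i j)"
    have "k < n \<Longrightarrow> k < mu A n" for k
      using strict_mono_imp_increasing[OF strict_mono_mu, of A n] A by auto
    then have "(i, j) \<in> restr n A" using A by (auto simp: restr_def n_def)
    then show "A \<in> \<Union>(?B ` {s \<in> Efin. (i, j) \<in> s})"
      using A restr_in_Efin[of A n] by blast
  qed (auto simp: restr_def)
  moreover have "openin Einf_topology (?B s)" if "s \<in> Efin" for s
    unfolding Einf_topology_def using that by (intro topology_generated_by_Basis) blast
  then have "openin Einf_topology (\<Union>(?B ` {s \<in> Efin. (i, j) \<in> s}))"
    by (intro openin_Union) auto
  ultimately show ?thesis
    unfolding sets_Einf_borel by (intro sigma_sets.Basic) simp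
qed

theorem lemma5p2:
  fixes f :: "(nat \<times> nat) set \<Rightarrow> (nat \<times> nat) set"
  assumes "f \<in> measurable Einf_borel Einf_borel"
  shows "\<exists>C. ramsey_conull C \<and> tracial_on f C"
proof -
  define good where "good B n \<longleftrightarrow> (\<forall>A \<in> Einf. \<forall>A' \<in> Einf.
        A \<preceq> B \<longrightarrow> A' \<preceq> B \<longrightarrow>
        (\<exists>k. \<exists>s \<in> Efin. s = restr k A \<and> s = restr k A' \<and> Domain s = {..<mu B n}) \<longrightarrow>
        tr (f A) B n = tr (f A') B n)" for B n
  define tracial_at where "tracial_at B \<longleftrightarrow> (\<exists>n0. \<forall>n\<ge>n0. good B n)" for B
  \<comment> \<open>All points at which \<open>f\<close> is tracial. What remains is that they are
    dense among the basic sets and closed under passing to coarser relations.\<close>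
  define C where "C = {B \<in> Einf. tracial_at B}"
  \<comment> \<open>On the cylinders below, \<open>first x n\<close> does not depend on
    \<open>x\<close>, so \<open>P\<close> says that the traces of \<open>f\<close> up to the n-th
    minimum coincide.\<close>
  define P where "P n S \<longleftrightarrow> (\<forall>x\<in>S. \<forall>y\<in>S. \<forall>i<first x n. \<forall>j<first x n.
        (i, j) \<in> f (ker_rel x) \<longleftrightarrow> (i, j) \<in> f (ker_rel y))" for n S
  have pair: "ramsey {x. (i, j) \<in> f (ker_rel x)}" for i j
  proof -
    have "f -` {A \<in> Einf. (i, j) \<in> A} \<inter> Einf \<in> sets Einf_borel"
      using measurable_sets[OF assms pair_set_borel] by (simp add: space_Einf_borel)
    then have R: "ramsey {x. ker_rel x \<in> f -` {A \<in> Einf. (i, j) \<in> A} \<inter> Einf}"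
      by (rule ramsey_borel)
    have "f (ker_rel x) \<in> Einf" if "rigid x" for x
      using measurable_space[OF assms, of "ker_rel x"] ker_rel_in_Einf[OF that] by (simp add: space_Einf_borel)
    then show ?thesis
      by (intro ramsey_cong[OF R]) (auto simp: ker_rel_in_Einf)
  qed
  have tracial: "\<exists>h\<in>cyl n0 id. tracial_at (ker_rel (h \<circ> z))" if z: "rigid z" for z n0
  proof -
    have "\<exists>h\<in>cyl n0 id. \<forall>g n. rigid g \<longrightarrow> n0 \<le> first g n \<longrightarrow> P n (below (cyl n g) (h \<circ> z))"
    proof (rule fusion_cyls[OF _ _ z])
      show "P n S'" if "S' \<subseteq> S" "P n S" for n S S'
        using that unfolding P_def by blast
    next
      fix n and x :: "nat \<Rightarrow> nat" assume x: "rigid x"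
      define M where "M = first x n"
      obtain h where h: "h \<in> cyl n id" and hom: "\<And>i j. i < M \<Longrightarrow> j < M \<Longrightarrow>
          below (cyl n id) (h \<circ> x) \<subseteq> {x. (i, j) \<in> f (ker_rel x)} \<or>
          below (cyl n id) (h \<circ> x) \<inter> {x. (i, j) \<in> f (ker_rel x)} = {}"
        using finite_family_homogeneous[of "{..<M} \<times> {..<M}" "\<lambda>(i, j). {x. (i, j) \<in> f (ker_rel x)}" x n]
          pair x by auto
      \<comment> \<open>Factors fixing \<open>0, ..., n\<close> do not move the n-th minimum, so the
        number of pairs to be decided is known in advance.\<close>
      have "first y n = M" if y: "y \<in> below (cyl n id) (h \<circ> x)" for y
      proof -
        obtain k where k: "k \<in> cyl n id" "y = k \<circ> h \<circ> x" using y by (auto simp: below_def comp_assoc)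
        have kh: "k \<circ> h \<in> cyl n id" using k(1) h by (rule cyl_id_comp)
        have "agree n x y" using cyl_id_comp_cyl[OF x kh] unfolding k(2) cyl_def by blast
        then show ?thesis unfolding M_def by (rule agree_first[OF x])
      qed
      then have "P n (below (cyl n id) (h \<circ> x))" using hom unfolding P_def by blast
      with h show "\<exists>h\<in>cyl n id. P n (below (cyl n id) (h \<circ> x))" by blast
    qed
    then obtain h where h: "h \<in> cyl n0 id" and
      hP: "\<And>g n. rigid g \<Longrightarrow> n0 \<le> first g n \<Longrightarrow> P n (below (cyl n g) (h \<circ> z))" by blast
    define b where "b = h \<circ> z"
    have b: "rigid b" using cyl_rigid[OF h] z by (simp add: b_def rigid_comp)
    have "tracial_at (ker_rel b)"
      unfolding tracial_at_def good_def
    proof (intro exI[of _ n0] allI ballI impI)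
      fix n A A' assume n: "n0 \<le> n" and A: "A \<in> Einf" "A' \<in> Einf" "A \<preceq> ker_rel b" "A' \<preceq> ker_rel b"
        and "\<exists>k. \<exists>s \<in> Efin. s = restr k A \<and> s = restr k A' \<and> Domain s = {..<mu (ker_rel b) n}"
      then obtain k where k: "restr k A = restr k A'" "Domain (restr k A) = {..<mu (ker_rel b) n}" by metis
      obtain g where g: "rigid g" "A = ker_rel (g \<circ> b)"
        using Einf_eq_ker_rel[OF A(1)] A(3) b coarser_ker_rel_iff by metis
      obtain g' where g': "rigid g'" "A' = ker_rel (g' \<circ> b)"
        using Einf_eq_ker_rel[OF A(2)] A(4) b coarser_ker_rel_iff by metis
      have r: "rigid (g \<circ> b)" "rigid (g' \<circ> b)" using g g' b by (simp_all add: rigid_comp)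
      have "agree k g g'"
        using k(1) restr_ker_rel_eq_iff[OF r, of k k] by (simp add: g g' agree_comp_iff b)
      \<comment> \<open>Here the domain condition is used: the k-th minimum of \<open>A\<close> is
        the n-th of \<open>b\<close>, so the minimum of class \<open>k\<close> of \<open>g\<close>
        is \<open>n\<close>, and the bound \<open>n0\<close> of the fusion is the bound for
        traciality.\<close>
      moreover have M: "first (g \<circ> b) k = mu (ker_rel b) n"
        using k(2) Domain_restr_ker_rel[OF r(1), of k] by (simp add: g lessThan_eq_iff)
      then have "first g k = n"
        using strict_mono_first[OF b] by (simp add: first_comp g b mu_ker_rel strict_mono_eq)
      ultimately have "P k (below (cyl k g) b)" "g \<circ> b \<in> below (cyl k g) b" "g' \<circ> b \<in> below (cyl k g) b"
        using hP[OF g(1), of k] n g g' by (auto simp: b_def below_def cyl_def)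
      then have "(i, j) \<in> f A \<longleftrightarrow> (i, j) \<in> f A'" if "i < mu (ker_rel b) n" "j < mu (ker_rel b) n" for i j
        using that unfolding P_def g(2) g'(2) M[symmetric] by blast
      then show "tr (f A) (ker_rel b) n = tr (f A') (ker_rel b) n" by (auto simp: tr_def)
    qed
    then show ?thesis using h by (auto simp: b_def)
  qed
  \<comment> \<open>The minima of \<open>D\<close> are among those of \<open>B\<close>, with index
    \<open>n\<close> becoming \<open>first g n \<ge> n\<close>. So the same \<open>n0\<close> serves
    for \<open>D\<close>.\<close>
  have hereditary: "tracial_at D" if B: "tracial_at B" "B \<in> Einf" "D \<in> Einf" "D \<preceq> B" for B D
  proof -
    obtain b where b: "rigid b" "B = ker_rel b" using Einf_eq_ker_rel[OF B(2)] .
    obtain d where d: "rigid d" "D = ker_rel d" using Einf_eq_ker_rel[OF B(3)] .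
    obtain g where g: "rigid g" "d = g \<circ> b" using B(4) coarser_ker_rel_iff b d by blast
    have mu_D: "mu D n = mu B (first g n)" for n by (simp add: b d(1,2) mu_ker_rel) (simp add: g b first_comp)
    have trans: "A \<preceq> B" if A: "A \<in> Einf" "A \<preceq> D" for A
    proof -
      obtain a where a: "rigid a" "A = ker_rel a" using Einf_eq_ker_rel[OF A(1)] .
      then obtain k where "rigid k" "a = k \<circ> d" using A(2) coarser_ker_rel_iff d by blast
      then show ?thesis using a b g coarser_ker_rel_iff[OF a(1) b(1)] rigid_comp[of k g] by (auto simp: comp_assoc)
    qed
    have "tr A D n = tr A B (first g n)" for A n by (simp add: tr_def mu_D)
    then have good: "good D n" if "good B (first g n)" for n
      using that trans unfolding good_def mu_D by simp
    obtain n0 where "\<And>n. n0 \<le> n \<Longrightarrow> good B n" using B(1) unfolding tracial_at_def by blast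
    then have "good D n" if "n0 \<le> n" for n
      using good le_trans[OF that le_first[OF g(1)]] by blast
    then show ?thesis unfolding tracial_at_def by blast
  qed
  have "ramsey_conull C"
    unfolding ramsey_conull_def ramsey_null_def
  proof (intro conjI ballI impI)
    fix s A assume A: "A \<in> Einf" and "basic s A \<noteq> {}"
    then obtain B n where B: "B \<in> Einf" "B \<preceq> A" "s = restr n B" by (auto simp: basic_def)
    obtain a where a: "rigid a" "A = ker_rel a" using Einf_eq_ker_rel[OF A] .
    obtain b where b: "rigid b" "B = ker_rel b" using Einf_eq_ker_rel[OF B(1)] .
    obtain g where g: "rigid g" "b = g \<circ> a" using B(2) coarser_ker_rel_iff a b by blast
    \<comment> \<open>\<open>h\<close> fixes \<open>0, ..., n\<close>, so \<open>h \<circ> b\<close>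
      keeps the initial part \<open>s\<close> and stays in the given basic set.\<close>
    obtain h where h: "h \<in> cyl n id" "tracial_at (ker_rel (h \<circ> b))" using tracial[OF b(1)] by blast
    have hr: "rigid h" "rigid (h \<circ> b)" using cyl_rigid[OF h(1)] b by (simp_all add: rigid_comp)
    have "ker_rel (h \<circ> b) \<preceq> A"
      using coarser_ker_rel_iff[OF hr(2) a(1)] rigid_comp[OF hr(1) g(1)] by (auto simp: a g comp_assoc)
    moreover have "s = restr n (ker_rel (h \<circ> b))"
      using cyl_id_comp_cyl[OF b(1) h(1)] restr_ker_rel_eq_iff[OF b(1) hr(2), of n n] B(3) b(2)
      by (simp add: cyl_def)
    ultimately have "ker_rel (h \<circ> b) \<in> basic s A"
      using ker_rel_in_Einf[OF hr(2)] by (auto simp: basic_def)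
    moreover have "basic s (ker_rel (h \<circ> b)) \<inter> (Einf - C) = {}"
      using hereditary[OF h(2) ker_rel_in_Einf[OF hr(2)]] by (auto simp: basic_def C_def)
    ultimately show "\<exists>B\<in>basic s A. basic s B \<inter> (Einf - C) = {}" by blast
  qed (auto simp: C_def)
  moreover have "tracial_on f C"
    by (simp add: tracial_on_def C_def tracial_at_def good_def)
  ultimately show ?thesis by blast
qed

end
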